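(* $\mathcal{M}_{\mathrm{loc}} = \mathcal{M}$. That is, for every plane geometric graph $G$ on $\mathbb{Z}^2$ of maximum degree at most $3$, one has $\mathrm{dil}(G) = 1+\sqrt{2}$ if and only if $\mathrm{dil}_G(p,q)\leq 1+\sqrt{2}$ for every pair of distinct points $p,q\in\mathbb{Z}^2$ with $|pq|\leq\sqrt{5}$.
   Context: A geometric graph $G$ on $\mathbb{Z}^2\subset\mathbb{R}^2$ is an undirected graph with vertex set $\mathbb{Z}^2$ whose edges are drawn as straight line segments between their endpoints. It is plane if no two edges intersect except possibly at a common endpoint vertex. The length of a path is the sum of the Euclidean lengths of its edges, and $d_G(p,q)$ denotes the length of a shortest path from $p$ to $q$ using only edges of $G$ ($+\infty$ if there is no such path). For distinct $p,q$ let $\mathrm{dil}_G(p,q) = d_G(p,q)/|pq|$, where $|pq|$ is the Euclidean distance, and let $\mathrm{dil}(G) = \sup_{p\neq q}\mathrm{dil}_G(p,q)$. $\mathcal{M}$ (optimal graphs) is the set of plane geometric graphs on $\mathbb{Z}^2$ of maximum degree at most $3$ with $\mathrm{dil}(G) = 1+\sqrt{2}$. $\mathcal{M}_{\mathrm{loc}}$ (locally optimal graphs) is the set of plane geometric graphs $G$ on $\mathbb{Z}^2$ of maximum degree at most $3$ such that $\mathrm{dil}_G(p,q)\leq 1+\sqrt{2}$ for all distinct $p,q\in\mathbb{Z}^2$ with $|pq|\leq\sqrt{5}$. *)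

theory Defs
  imports "HOL-Analysis.Analysis"
begin

type_synonym vertex = "int \<times> int"

text \<open>The inclusion of the integer lattice in the plane. The distance of the type
  \<^typ>\<open>real \<times> real\<close> is the Euclidean one.\<close>

definition pt :: "vertex \<Rightarrow> real \<times> real" where
  "pt p = (real_of_int (fst p), real_of_int (snd p))"

text \<open>The vertex set is always the whole lattice, so a geometric graph is given by its
  set of edges, an edge being the unordered pair of its endpoints.\<close>

type_synonym edges = "vertex set set"

definition geometric_graph :: "edges \<Rightarrow> bool" where
  "geometric_graph E \<longleftrightarrow> (\<forall>e\<in>E. \<exists>u v. u \<noteq> v \<and> e = {u, v})"

text \<open>Distinct edges may meet only in points that are endpoints of both.\<close>

definition plane_graph :: "edges \<Rightarrow> bool" where
  "plane_graph E \<longleftrightarrow>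
     (\<forall>u v w x. {u, v} \<in> E \<and> {w, x} \<in> E \<and> {u, v} \<noteq> {w, x} \<longrightarrow>
        closed_segment (pt u) (pt v) \<inter> closed_segment (pt w) (pt x) \<subseteq> pt ` ({u, v} \<inter> {w, x}))"

text \<open>Finiteness is explicit because \<^const>\<open>card\<close> is 0 on infinite sets.\<close>

definition max_degree_le :: "nat \<Rightarrow> edges \<Rightarrow> bool" where
  "max_degree_le k E \<longleftrightarrow> (\<forall>v. finite {e \<in> E. v \<in> e} \<and> card {e \<in> E. v \<in> e} \<le> k)"

definition graph_path :: "edges \<Rightarrow> vertex \<Rightarrow> vertex \<Rightarrow> vertex list \<Rightarrow> bool" where
  "graph_path E p q xs \<longleftrightarrow>
     xs \<noteq> [] \<and> hd xs = p \<and> last xs = q \<and> distinct xs \<and> successively (\<lambda>u v. {u, v} \<in> E) xs"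

definition path_len :: "vertex list \<Rightarrow> real" where
  "path_len xs = sum_list (map2 (\<lambda>u v. dist (pt u) (pt v)) xs (tl xs))"

text \<open>If there is no path, this is the infimum of the empty set, that is \<open>\<infinity>\<close>.
  Otherwise, if all degrees are finite, the infimum is attained by a shortest path, because
  edges have length at least 1 and so only finitely many paths from \<open>p\<close> are shorter than
  any given bound.\<close>

definition graph_dist :: "edges \<Rightarrow> vertex \<Rightarrow> vertex \<Rightarrow> ereal" where
  "graph_dist E p q = (INF xs \<in> {xs. graph_path E p q xs}. ereal (path_len xs))"

definition dil_pair :: "edges \<Rightarrow> vertex \<Rightarrow> vertex \<Rightarrow> ereal" where
  "dil_pair E p q = graph_dist E p q / ereal (dist (pt p) (pt q))"

definition dil :: "edges \<Rightarrow> ereal" where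
  "dil E = (SUP (p, q) \<in> {(p, q). p \<noteq> q}. dil_pair E p q)"

definition optimal_graphs :: "edges set" ("\<M>") where
  "\<M> = {E. geometric_graph E \<and> plane_graph E \<and> max_degree_le 3 E \<and> dil E = ereal (1 + sqrt 2)}"

definition locally_optimal_graphs :: "edges set" ("\<M>\<^sub>l\<^sub>o\<^sub>c") where
  "\<M>\<^sub>l\<^sub>o\<^sub>c = {E. geometric_graph E \<and> plane_graph E \<and> max_degree_le 3 E \<and>
     (\<forall>p q. p \<noteq> q \<and> dist (pt p) (pt q) \<le> sqrt 5 \<longrightarrow> dil_pair E p q \<le> ereal (1 + sqrt 2))}"

end

theory Submission
  imports Defs
begin

text \<open>Maximum degree 3 forces a missing edge between two lattice neighbours, and any other path between
  them has length at least \<open>1 + sqrt 2\<close>, so the dilation is never smaller than that. For the converse,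
  local optimality forces every pair at distance 1 to be joined by an edge or by a unit edge followed by
  a diagonal one, which excludes all edges longer than \<open>sqrt 2\<close>. The decisive fact is that a pair
  at distance \<open>sqrt 5\<close> (a knight's move) is then joined by a path of length at most \<open>3 + sqrt 2\<close>,
  although only \<open>(1 + sqrt 2) * sqrt 5\<close> is assumed: the candidates in between use five unit edges, or one
  unit and three diagonal edges, and each of them forces so many edges around it that some
  neighbouring pair has no admissible path. With the bounds \<open>1 + sqrt 2\<close>, \<open>2 + sqrt 2\<close> and
  \<open>3 + sqrt 2\<close> for the vectors \<open>(1, 0)\<close>, \<open>(1, 1)\<close> and \<open>(2, 1)\<close>, decomposing a vector of the octant
  \<open>0 \<le> y \<le> x\<close> along the two of them that enclose it gives the global bound.\<close>

subsection \<open>Paths and distances\<close>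

text \<open>A real bound witnessed by one concrete path. It replaces the extended real infimum
  \<open>graph_dist\<close> in all geometric arguments; \<open>graph_dist_le_iff\<close> justifies
  this.\<close>

definition reaches :: "edges \<Rightarrow> vertex \<Rightarrow> vertex \<Rightarrow> real \<Rightarrow> bool" where
  "reaches E p q L \<longleftrightarrow> (\<exists>xs. graph_path E p q xs \<and> path_len xs \<le> L)"

lemma path_len_simps [simp]:
  "path_len [] = 0" "path_len [x] = 0"
  "path_len (x # y # xs) = dist (pt x) (pt y) + path_len (y # xs)"
  by (simp_all add: path_len_def)

lemma path_len_nonneg [simp]: "0 \<le> path_len xs"
  by (induction xs rule: induct_list012) auto

lemma path_len_append:
  "path_len (xs @ x # ys) = path_len (xs @ [x]) + path_len (x # ys)"
proof (induction xs)
  case (Cons a xs)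
  then show ?case by (cases xs) auto
qed simp

lemma dist_le_path_len:
  assumes "z \<in> set (x # xs)"
  shows "dist (pt x) (pt z) \<le> path_len (x # xs)"
  using assms
proof (induction xs arbitrary: x)
  case (Cons y xs)
  show ?case
  proof (cases "z = x")
    case False
    then have "dist (pt y) (pt z) \<le> path_len (y # xs)"
      using Cons by auto
    then show ?thesis
      using dist_triangle[of "pt x" "pt z" "pt y"] by simp
  qed (simp add: add_nonneg_nonneg)
qed simp

section \<open>Attainment of the graph distance\<close>

lemma finite_pt_cball: "finite {z. dist (pt p) (pt z) \<le> L}"
proof (rule finite_subset)
  show "{z. dist (pt p) (pt z) \<le> L} \<subseteq> {fst p - \<lceil>L\<rceil>..fst p + \<lceil>L\<rceil>} \<times> {snd p - \<lceil>L\<rceil>..snd p + \<lceil>L\<rceil>}"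
  proof
    fix z assume z: "z \<in> {z. dist (pt p) (pt z) \<le> L}"
    have "\<bar>real_of_int (fst p - fst z)\<bar> \<le> L" "\<bar>real_of_int (snd p - snd z)\<bar> \<le> L"
      using z dist_fst_le[of "pt p" "pt z"] dist_snd_le[of "pt p" "pt z"]
      by (auto simp: pt_def dist_real_def)
    then have "\<bar>fst p - fst z\<bar> \<le> \<lceil>L\<rceil>" "\<bar>snd p - snd z\<bar> \<le> \<lceil>L\<rceil>"
      by linarith+
    then show "z \<in> {fst p - \<lceil>L\<rceil>..fst p + \<lceil>L\<rceil>} \<times> {snd p - \<lceil>L\<rceil>..snd p + \<lceil>L\<rceil>}"
      by (cases z) auto
  qed
qed simp

text \<open>By the triangle inequality, all vertices of such a path lie within \<open>L\<close> of
  its start. They form a finite set, and a path repeats no vertex.\<close>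

lemma finite_short_paths: "finite {xs. graph_path E p q xs \<and> path_len xs \<le> L}"
proof (rule finite_subset)
  show "{xs. graph_path E p q xs \<and> path_len xs \<le> L}
      \<subseteq> {xs. set xs \<subseteq> {z. dist (pt p) (pt z) \<le> L} \<and> distinct xs}"
  proof clarify
    fix xs assume xs: "graph_path E p q xs" "path_len xs \<le> L"
    then obtain ys where ys: "xs = p # ys"
      by (cases xs) (auto simp: graph_path_def)
    have "dist (pt p) (pt z) \<le> L" if "z \<in> set xs" for z
      using dist_le_path_len[of z p ys] that xs(2) by (simp add: ys)
    then show "set xs \<subseteq> {z. dist (pt p) (pt z) \<le> L} \<and> distinct xs"
      using xs by (auto simp: graph_path_def)
  qed
  show "finite {xs. set xs \<subseteq> {z. dist (pt p) (pt z) \<le> L} \<and> distinct xs}"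
    using finite_subset_distinct[OF finite_pt_cball] by simp
qed

text \<open>The infimum is attained, so a bound on it is realised by a path, even when no slack is
  allowed.\<close>

lemma graph_dist_le_iff: "graph_dist E p q \<le> ereal L \<longleftrightarrow> reaches E p q L"
proof
  assume le: "graph_dist E p q \<le> ereal L"
  \<comment> \<open>The slack 1 guarantees that \<open>?S\<close> is nonempty: an infimum of at most
    \<open>L\<close> is strictly below \<open>L + 1\<close>. A minimiser over this finite set is
    then a minimiser over all paths.\<close>
  let ?S = "{xs. graph_path E p q xs \<and> path_len xs \<le> L + 1}"
  have "graph_dist E p q < ereal (L + 1)"
    using le by (rule le_less_trans) simp
  then obtain xs where xs: "graph_path E p q xs" "path_len xs < L + 1"
    by (auto simp: graph_dist_def INF_less_iff)
  then have ne: "?S \<noteq> {}"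
    by force
  have fin: "finite ?S"
    by (rule finite_short_paths)
  define ys where "ys = arg_min_on path_len ?S"
  have ys: "ys \<in> ?S" "\<And>xs. xs \<in> ?S \<Longrightarrow> path_len ys \<le> path_len xs"
    unfolding ys_def using arg_min_if_finite[OF fin ne, of path_len] arg_min_least[OF fin ne, of _ path_len]
    by auto
  have "ereal (path_len ys) \<le> graph_dist E p q"
    unfolding graph_dist_def
  proof (rule INF_greatest)
    fix xs assume "xs \<in> {xs. graph_path E p q xs}"
    then show "ereal (path_len ys) \<le> ereal (path_len xs)"
      using ys by (cases "path_len xs \<le> L + 1") auto
  qed
  then have "path_len ys \<le> L"
    using le by (meson ereal_less_eq(3) order_trans)
  then show "reaches E p q L"
    using ys by (auto simp: reaches_def)
next
  assume "reaches E p q L"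
  then obtain xs where "graph_path E p q xs" "path_len xs \<le> L"
    by (auto simp: reaches_def)
  then show "graph_dist E p q \<le> ereal L"
    unfolding graph_dist_def by (intro INF_lower2[of xs]) auto
qed

lemma inj_pt: "inj pt"
  by (auto simp: inj_def pt_def prod_eq_iff)

lemma dil_pair_le_iff:
  assumes "p \<noteq> q"
  shows "dil_pair E p q \<le> ereal K \<longleftrightarrow> reaches E p q (K * dist (pt p) (pt q))"
proof -
  have "0 < dist (pt p) (pt q)"
    using assms inj_pt by (simp add: inj_eq)
  then have "dil_pair E p q \<le> ereal K \<longleftrightarrow> graph_dist E p q \<le> ereal (dist (pt p) (pt q)) * ereal K"
    unfolding dil_pair_def by (intro ereal_divide_le_pos) auto
  then show ?thesis
    by (simp add: graph_dist_le_iff mult.commute)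
qed

text \<open>Vertices may repeat, so walks can be concatenated and their length bounds added, which
  fails for paths.\<close>

definition walk :: "edges \<Rightarrow> vertex \<Rightarrow> vertex \<Rightarrow> real \<Rightarrow> bool" where
  "walk E p q L \<longleftrightarrow> (\<exists>xs. xs \<noteq> [] \<and> hd xs = p \<and> last xs = q \<and>
     successively (\<lambda>u v. {u, v} \<in> E) xs \<and> path_len xs \<le> L)"

lemma reaches_imp_walk: "reaches E p q L \<Longrightarrow> walk E p q L"
  by (auto simp: reaches_def walk_def graph_path_def)

lemma walk_mono: "walk E p q L \<Longrightarrow> L \<le> L' \<Longrightarrow> walk E p q L'"
  by (force simp: walk_def)

text \<open>Cutting out the closed subwalk between two occurrences of a vertex keeps the ends and
  does not lengthen the walk; induction on the number of vertices ends at a path.\<close>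

lemma walk_imp_reaches:
  assumes "walk E p q L"
  shows "reaches E p q L"
proof -
  have "\<exists>ys. graph_path E (hd xs) (last xs) ys \<and> path_len ys \<le> path_len xs"
    if "xs \<noteq> []" "successively (\<lambda>u v. {u, v} \<in> E) xs" for xs
    using that
  proof (induction "length xs" arbitrary: xs rule: less_induct)
    case less
    show ?case
    proof (cases "distinct xs")
      case True
      then show ?thesis
        using less by (auto simp: graph_path_def)
    next
      case False
      then obtain as bs cs y where xs: "xs = as @ [y] @ bs @ [y] @ cs"
        using not_distinct_decomp by blast
      let ?ys = "as @ [y] @ cs"
      have "successively (\<lambda>u v. {u, v} \<in> E) ?ys"
        using less(3) unfolding xs by (auto simp: successively_append_iff successively_Cons)
      moreover have "path_len ?ys \<le> path_len xs"
        using path_len_append[of as y cs] path_len_append[of as y "bs @ [y] @ cs"]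
          path_len_append[of "y # bs" y cs]
          path_len_nonneg[of "(y # bs) @ [y]"]
        unfolding xs by (simp del: path_len_nonneg)
      moreover have "hd ?ys = hd xs" "last ?ys = last xs"
        unfolding xs by (cases as; simp)+
      ultimately show ?thesis
        using less(1)[of ?ys] xs by fastforce
    qed
  qed
  then show ?thesis
    using assms unfolding walk_def reaches_def by (meson order_trans)
qed

lemma walk_refl: "0 \<le> L \<Longrightarrow> walk E p p L"
  unfolding walk_def by (rule exI[of _ "[p]"]) simp

lemma walk_trans:
  assumes "walk E p q L" "walk E q r M"
  shows "walk E p r (L + M)"
proof -
  obtain xs where xs: "xs \<noteq> []" "hd xs = p" "last xs = q" "successively (\<lambda>u v. {u, v} \<in> E) xs" "path_len xs \<le> L"
    using assms by (auto simp: walk_def)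
  obtain ys where ys: "ys \<noteq> []" "hd ys = q" "last ys = r" "successively (\<lambda>u v. {u, v} \<in> E) ys" "path_len ys \<le> M"
    using assms by (auto simp: walk_def)
  obtain as where as: "xs = as @ [q]"
    using xs by (metis append_butlast_last_id)
  obtain bs where bs: "ys = q # bs"
    using ys by (metis list.collapse)
  have "successively (\<lambda>u v. {u, v} \<in> E) (as @ q # bs)"
    using xs(4) ys(4) unfolding as bs by (auto simp: successively_append_iff successively_Cons)
  moreover have "hd (as @ q # bs) = p"
    using xs as by (cases as) auto
  moreover have "last (as @ q # bs) = r"
    using ys bs by auto
  moreover have "path_len (as @ q # bs) \<le> L + M"
    using xs(5) ys(5) path_len_append[of as q bs] as bs by simp
  ultimately show ?thesis
    unfolding walk_def by (intro exI[of _ "as @ q # bs"]) simp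
qed

subsection \<open>Lattice isometries\<close>

definition local_spanner :: "edges \<Rightarrow> bool" where
  "local_spanner E \<longleftrightarrow> geometric_graph E \<and> plane_graph E \<and> max_degree_le 3 E \<and>
     (\<forall>p q. p \<noteq> q \<and> dist (pt p) (pt q) \<le> sqrt 5 \<longrightarrow> reaches E p q ((1 + sqrt 2) * dist (pt p) (pt q)))"

lemma local_spannerD:
  assumes "local_spanner E"
  shows "e \<in> E \<Longrightarrow> \<exists>u v. u \<noteq> v \<and> e = {u, v}"
    and "{u, v} \<in> E \<Longrightarrow> {w, x} \<in> E \<Longrightarrow> {u, v} \<noteq> {w, x} \<Longrightarrow>
        closed_segment (pt u) (pt v) \<inter> closed_segment (pt w) (pt x) \<subseteq> pt ` ({u, v} \<inter> {w, x})"
    and "finite {e \<in> E. v \<in> e}"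
    and "card {e \<in> E. v \<in> e} \<le> 3"
    and "p \<noteq> q \<Longrightarrow> dist (pt p) (pt q) \<le> sqrt 5 \<Longrightarrow> reaches E p q ((1 + sqrt 2) * dist (pt p) (pt q))"
proof -
  have E: "geometric_graph E" "plane_graph E" "max_degree_le 3 E"
    "\<forall>p q. p \<noteq> q \<and> dist (pt p) (pt q) \<le> sqrt 5 \<longrightarrow> reaches E p q ((1 + sqrt 2) * dist (pt p) (pt q))"
    using assms unfolding local_spanner_def by blast+
  show "e \<in> E \<Longrightarrow> \<exists>u v. u \<noteq> v \<and> e = {u, v}"
    using E(1) unfolding geometric_graph_def by blast
  show "{u, v} \<in> E \<Longrightarrow> {w, x} \<in> E \<Longrightarrow> {u, v} \<noteq> {w, x} \<Longrightarrow>
      closed_segment (pt u) (pt v) \<inter> closed_segment (pt w) (pt x) \<subseteq> pt ` ({u, v} \<inter> {w, x})"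
    using E(2)[unfolded plane_graph_def, rule_format, of u v w x] by blast
  show "finite {e \<in> E. v \<in> e}" "card {e \<in> E. v \<in> e} \<le> 3"
    using E(3)[unfolded max_degree_le_def, rule_format, of v] by simp_all
  show "p \<noteq> q \<Longrightarrow> dist (pt p) (pt q) \<le> sqrt 5 \<Longrightarrow> reaches E p q ((1 + sqrt 2) * dist (pt p) (pt q))"
    using E(4) by blast
qed

lemma locally_optimal_iff: "E \<in> locally_optimal_graphs \<longleftrightarrow> local_spanner E"
  unfolding locally_optimal_graphs_def local_spanner_def using dil_pair_le_iff by auto

text \<open>The affine map with matrix rows \<open>(a, b)\<close> and \<open>(c, d)\<close> and
  translation \<open>(s, t)\<close>. Under \<open>signed_perm\<close> the matrix is one of the eight
  symmetries of the square, and the map is an isometry of the lattice.\<close>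

definition frame :: "int \<Rightarrow> int \<Rightarrow> int \<Rightarrow> int \<Rightarrow> int \<Rightarrow> int \<Rightarrow> vertex \<Rightarrow> vertex" where
  "frame a b c d s t = (\<lambda>(x, y). (a * x + b * y + s, c * x + d * y + t))"

definition signed_perm :: "int \<Rightarrow> int \<Rightarrow> int \<Rightarrow> int \<Rightarrow> bool" where
  "signed_perm a b c d \<longleftrightarrow>
     (a, b, c, d) \<in> {(1, 0, 0, 1), (1, 0, 0, -1), (-1, 0, 0, 1), (-1, 0, 0, -1),
       (0, 1, 1, 0), (0, 1, -1, 0), (0, -1, 1, 0), (0, -1, -1, 0)}"

lemma signed_permE:
  assumes "signed_perm a b c d"
  obtains "a = 1" "b = 0" "c = 0" "d = 1" | "a = 1" "b = 0" "c = 0" "d = -1"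
    | "a = -1" "b = 0" "c = 0" "d = 1" | "a = -1" "b = 0" "c = 0" "d = -1"
    | "a = 0" "b = 1" "c = 1" "d = 0" | "a = 0" "b = 1" "c = -1" "d = 0"
    | "a = 0" "b = -1" "c = 1" "d = 0" | "a = 0" "b = -1" "c = -1" "d = 0"
  using assms by (auto simp: signed_perm_def)

text \<open>Taking preimages of edges makes adjacency in \<open>pull T E\<close> unfold to adjacency
  in \<open>E\<close> of the images. A fact about all graphs in standard position, applied to
  \<open>pull T E\<close>, thus becomes a fact about \<open>E\<close> at the position given by
  \<open>T\<close>.\<close>

definition pull :: "(vertex \<Rightarrow> vertex) \<Rightarrow> edges \<Rightarrow> edges" where
  "pull T E = {e. T ` e \<in> E}"

lemma pull_iff [simp]: "{u, v} \<in> pull T E \<longleftrightarrow> {T u, T v} \<in> E"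
  by (simp add: pull_def)

lemma bij_frame:
  assumes "signed_perm a b c d"
  shows "bij (frame a b c d s t)"
proof (rule bijI')
  fix p q show "(frame a b c d s t p = frame a b c d s t q) = (p = q)"
    using assms by (elim signed_permE) (auto simp: frame_def split: prod.splits)
next
  fix q
  \<comment> \<open>The matrix is orthogonal, so its transpose is its inverse.\<close>
  have "q = frame a b c d s t (a * (fst q - s) + c * (snd q - t), b * (fst q - s) + d * (snd q - t))"
    using assms by (elim signed_permE) (simp_all add: frame_def split: prod.splits)
  then show "\<exists>p. q = frame a b c d s t p"
    by (rule exI)
qed

lemma dist_pt: "dist (pt p) (pt q) = sqrt ((real_of_int (fst p - fst q))\<^sup>2 + (real_of_int (snd p - snd q))\<^sup>2)"
  by (simp add: pt_def dist_Pair_Pair dist_real_def)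

lemma dist_frame:
  assumes "signed_perm a b c d"
  shows "dist (pt (frame a b c d s t p)) (pt (frame a b c d s t q)) = dist (pt p) (pt q)"
  using assms unfolding dist_pt
  by (elim signed_permE; cases p; cases q) (simp_all add: frame_def power2_commute add.commute)

lemma pt_frame:
  "pt (frame a b c d s t p) = (real_of_int s, real_of_int t) +
     (real_of_int a * fst (pt p) + real_of_int b * snd (pt p), real_of_int c * fst (pt p) + real_of_int d * snd (pt p))"
  by (cases p) (simp add: frame_def pt_def)

lemma segment_frame:
  "closed_segment (pt (frame a b c d s t u)) (pt (frame a b c d s t v)) =
     (\<lambda>z. (real_of_int s, real_of_int t) +
       (real_of_int a * fst z + real_of_int b * snd z, real_of_int c * fst z + real_of_int d * snd z))
       ` closed_segment (pt u) (pt v)"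
proof -
  let ?L = "\<lambda>z::real \<times> real. (real_of_int a * fst z + real_of_int b * snd z, real_of_int c * fst z + real_of_int d * snd z)"
  have "linear ?L"
    by (rule linearI) (auto simp: algebra_simps)
  then show ?thesis
    unfolding pt_frame closed_segment_translation
    by (subst closed_segment_linear_image) (simp_all add: image_image)
qed

text \<open>A lattice symmetry is a bijection of the vertices and extends to an injective affine
  isometry of the plane. Hence it respects segments and their intersections, degrees and path
  lengths, and later arguments may fix one position and orientation.\<close>

lemma local_spanner_pull:
  assumes E: "local_spanner E" and sp: "signed_perm a b c d"
  shows "local_spanner (pull (frame a b c d s t) E)"
proof -
  let ?T = "frame a b c d s t"
  have bij: "bij ?T" using bij_frame[OF sp] .
  then have inj: "inj ?T" and surj: "surj ?T"
    by (auto simp: bij_def)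
  have geo: "geometric_graph (pull ?T E)"
    unfolding geometric_graph_def
  proof
    fix e assume "e \<in> pull ?T E"
    then have "?T ` e \<in> E"
      by (simp add: pull_def)
    then obtain u v where uv: "u \<noteq> v" "?T ` e = {u, v}"
      using local_spannerD(1)[OF E] by blast
    obtain u' v' where "u = ?T u'" "v = ?T v'"
      using surj by (metis surjD)
    with uv have "u' \<noteq> v'" "?T ` e = ?T ` {u', v'}"
      by auto
    then show "\<exists>u v. u \<noteq> v \<and> e = {u, v}"
      using inj inj_image_eq_iff by metis
  qed
  have plane: "plane_graph (pull ?T E)"
    unfolding plane_graph_def
  proof (intro allI impI)
    fix u v w x assume *: "{u, v} \<in> pull ?T E \<and> {w, x} \<in> pull ?T E \<and> {u, v} \<noteq> {w, x}"
    let ?f = "\<lambda>z. (real_of_int s, real_of_int t) +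
       (real_of_int a * fst z + real_of_int b * snd z, real_of_int c * fst z + real_of_int d * snd z)"
    have inj_f: "inj ?f"
      using sp by (elim signed_permE) (auto simp: inj_def prod_eq_iff)
    have ne: "?T ` {u, v} \<noteq> ?T ` {w, x}"
      using * inj by (simp only: inj_image_eq_iff simp_thms)
    have "closed_segment (pt (?T u)) (pt (?T v)) \<inter> closed_segment (pt (?T w)) (pt (?T x))
        \<subseteq> pt ` (?T ` {u, v} \<inter> ?T ` {w, x})"
      using * ne local_spannerD(2)[OF E] unfolding pull_iff image_insert image_empty by blast
    also have "\<dots> = ?f ` pt ` ({u, v} \<inter> {w, x})"
      by (simp only: image_Int[OF inj, symmetric] image_image pt_frame)
    finally have "?f ` (closed_segment (pt u) (pt v) \<inter> closed_segment (pt w) (pt x)) \<subseteq> ?f ` pt ` ({u, v} \<inter> {w, x})"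
      by (simp only: segment_frame image_Int[OF inj_f])
    then show "closed_segment (pt u) (pt v) \<inter> closed_segment (pt w) (pt x) \<subseteq> pt ` ({u, v} \<inter> {w, x})"
      using inj_f by (simp only: inj_image_subset_iff)
  qed
  have deg: "max_degree_le 3 (pull ?T E)"
    unfolding max_degree_le_def
  proof
    fix v
    have inj': "inj_on ((`) ?T) {e \<in> pull ?T E. v \<in> e}"
      using inj by (simp add: inj_on_def inj_image_eq_iff)
    have sub: "(`) ?T ` {e \<in> pull ?T E. v \<in> e} \<subseteq> {e \<in> E. ?T v \<in> e}"
      by (auto simp: pull_def)
    note fin = local_spannerD(3,4)[OF E, of "?T v"]
    show "finite {e \<in> pull ?T E. v \<in> e} \<and> card {e \<in> pull ?T E. v \<in> e} \<le> 3"
      using inj_on_finite[OF inj' sub fin(1)] card_inj_on_le[OF inj' sub fin(1)] fin(2) by linarith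
  qed
  have "reaches (pull ?T E) p q ((1 + sqrt 2) * dist (pt p) (pt q))"
    if "p \<noteq> q" "dist (pt p) (pt q) \<le> sqrt 5" for p q
  proof -
    have "?T p \<noteq> ?T q" "dist (pt (?T p)) (pt (?T q)) \<le> sqrt 5"
      using that inj by (auto simp: dist_frame[OF sp] inj_eq)
    then have "reaches E (?T p) (?T q) ((1 + sqrt 2) * dist (pt p) (pt q))"
      using local_spannerD(5)[OF E, of "?T p" "?T q"] by (simp add: dist_frame[OF sp])
    then obtain xs where xs: "graph_path E (?T p) (?T q) xs" "path_len xs \<le> (1 + sqrt 2) * dist (pt p) (pt q)"
      by (auto simp: reaches_def)
    define ys where "ys = map (inv ?T) xs"
    have xs_ys: "xs = map ?T ys"
      using surj by (simp add: ys_def surj_iff)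
    have "graph_path (pull ?T E) p q ys"
      using xs(1) inj unfolding xs_ys graph_path_def
      by (auto simp: hd_map last_map inj_eq distinct_map successively_map)
    moreover have "path_len (map ?T zs) = path_len zs" for zs
      by (induction zs rule: induct_list012) (auto simp: dist_frame[OF sp])
    ultimately show ?thesis
      using xs(2) unfolding xs_ys reaches_def by auto
  qed
  with geo plane deg show ?thesis
    by (simp add: local_spanner_def)
qed

subsection \<open>Unit pairs and the exclusion of long edges\<close>

text \<open>The representative in the octant has the larger absolute coordinate first and the
  smaller second; signs and order are restored by the matrix.\<close>

lemma lattice_orientation:
  obtains a b c d x y :: int
  where "0 \<le> y" "y \<le> x" "signed_perm a b c d" "dx = a * x + b * y" "dy = c * x + d * y"
proof -
  have "\<exists>a b c d. signed_perm a b c d \<and> dx = a * max \<bar>dx\<bar> \<bar>dy\<bar> + b * min \<bar>dx\<bar> \<bar>dy\<bar>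
      \<and> dy = c * max \<bar>dx\<bar> \<bar>dy\<bar> + d * min \<bar>dx\<bar> \<bar>dy\<bar>"
  proof (cases "\<bar>dy\<bar> \<le> \<bar>dx\<bar>")
    case True
    then show ?thesis
      by (intro exI[of _ "if dx < 0 then -1 else 1"] exI[of _ 0] exI[of _ "if dy < 0 then -1 else 1"])
        (auto simp: signed_perm_def)
  next
    case False
    then show ?thesis
      by (intro exI[of _ 0] exI[of _ "if dx < 0 then -1 else 1"] exI[of _ "if dy < 0 then -1 else 1"])
        (auto simp: signed_perm_def)
  qed
  then obtain a b c d where "signed_perm a b c d"
    "dx = a * max \<bar>dx\<bar> \<bar>dy\<bar> + b * min \<bar>dx\<bar> \<bar>dy\<bar>"
    "dy = c * max \<bar>dx\<bar> \<bar>dy\<bar> + d * min \<bar>dx\<bar> \<bar>dy\<bar>"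
    by blast
  then show ?thesis
    by (rule that[rotated 2]) auto
qed

lemma dist_pt_ge_1:
  assumes "p \<noteq> q"
  shows "1 \<le> dist (pt p) (pt q)"
proof -
  have "0 < (fst p - fst q)\<^sup>2 + (snd p - snd q)\<^sup>2"
    using assms by (simp add: sum_power2_gt_zero_iff prod_eq_iff)
  then have "1 \<le> real_of_int ((fst p - fst q)\<^sup>2 + (snd p - snd q)\<^sup>2)"
    by linarith
  then show ?thesis
    unfolding dist_pt by simp
qed

lemma length_le_path_len:
  assumes "distinct (x # xs)"
  shows "real (length xs) \<le> path_len (x # xs)"
  using assms
proof (induction xs arbitrary: x)
  case (Cons y xs)
  then have "1 \<le> dist (pt x) (pt y)" "real (length xs) \<le> path_len (y # xs)"
    using dist_pt_ge_1 by auto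
  then show ?case by simp
qed simp

text \<open>Let \<open>m\<close> and \<open>n\<close> be the squared distances to the two ends. They
  cannot both be at least 2, as \<open>2 * sqrt 2\<close> exceeds \<open>1 + sqrt 2\<close>; so one
  is 1 and the other at most 2. Their parities differ, so the other is exactly 2.\<close>

lemma triangle_vertices:
  fixes a b :: int
  assumes "(a, b) \<noteq> (0, 0)" "(a, b) \<noteq> (1, 0)"
    and le: "dist (pt (0, 0)) (pt (a, b)) + dist (pt (a, b)) (pt (1, 0)) \<le> 1 + sqrt 2"
  shows "(a, b) \<in> {(0, 1), (0, -1), (1, 1), (1, -1)}"
proof -
  define m n where "m = a\<^sup>2 + b\<^sup>2" and "n = (a - 1)\<^sup>2 + b\<^sup>2"
  have mn: "n = m - 2 * a + 1"
    by (simp add: m_def n_def power2_eq_square algebra_simps)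
  have m: "0 < m" and n: "0 < n"
    using assms unfolding m_def n_def by (simp_all add: sum_power2_gt_zero_iff)
  have le': "sqrt (real_of_int m) + sqrt (real_of_int n) \<le> 1 + sqrt 2"
    using le by (simp add: dist_pt m_def n_def)
  have small: "j \<le> 2" if "sqrt (real_of_int j) \<le> sqrt 2" for j
    using that by simp
  have "m = 1 \<or> n = 1"
  proof (rule ccontr)
    assume "\<not> ?thesis"
    then have "2 \<le> m" "2 \<le> n"
      using m n by auto
    then have "sqrt 2 \<le> sqrt (real_of_int m)" "sqrt 2 \<le> sqrt (real_of_int n)"
      by simp_all
    moreover have "1 < sqrt 2"
      by simp
    ultimately show False
      using le' by linarith
  qed
  then have "m = 1 \<and> n \<le> 2 \<or> n = 1 \<and> m \<le> 2"
    using le' small[of n] small[of m] by auto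
  then have "m = 1 \<and> n = 2 \<or> n = 1 \<and> m = 2"
    using mn m n by presburger
  then have "a = 0 \<and> m = 1 \<or> a = 1 \<and> n = 1"
    using mn by presburger
  then have "a = 0 \<and> b\<^sup>2 = 1 \<or> a = 1 \<and> b\<^sup>2 = 1"
    by (auto simp: m_def n_def)
  then show ?thesis
    by (auto simp: power2_eq_1_iff)
qed

text \<open>Edges have length at least 1 and \<open>1 + sqrt 2 < 3\<close>, so an admissible path
  has at most two edges; \<open>triangle_vertices\<close> lists the possible middle
  vertices.\<close>

lemma unit_pair_origin:
  assumes E: "local_spanner E"
  shows "{(0, 0), (1, 0)} \<in> E \<or>
    (\<exists>r \<in> {(0, 1), (0, -1), (1, 1), (1, -1)}. {(0, 0), r} \<in> E \<and> {r, (1, 0)} \<in> E)"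
proof -
  have d: "dist (pt (0, 0)) (pt (1, 0)) = 1"
    by (simp add: dist_pt)
  then obtain xs where xs: "graph_path E (0, 0) (1, 0) xs" "path_len xs \<le> 1 + sqrt 2"
    using local_spannerD(5)[OF E, of "(0, 0)" "(1, 0)"] by (auto simp: reaches_def)
  then obtain ys where ys: "xs = (0, 0) # ys" "ys \<noteq> []" "last ys = (1, 0)"
    by (cases xs) (auto simp: graph_path_def split: if_splits)
  have dis: "distinct ((0, 0) # ys)" and suc: "successively (\<lambda>u v. {u, v} \<in> E) ((0, 0) # ys)"
    using xs ys by (auto simp: graph_path_def)
  have "real (length ys) \<le> 1 + sqrt 2"
    using length_le_path_len[OF dis] xs(2) ys by simp
  moreover have "sqrt 2 < 2"
    by (simp add: real_less_rsqrt sqrt2_less_2)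
  ultimately have "length ys < 3"
    by linarith
  then consider u where "ys = [u]" | u v where "ys = [u, v]"
    using ys(2) by (cases ys; cases "tl ys") (auto simp: neq_Nil_conv)
  then show ?thesis
  proof cases
    case 1
    then show ?thesis
      using suc ys by auto
  next
    case 2
    then show ?thesis
      using suc dis ys xs(2) triangle_vertices[of "fst u" "snd u"] by (cases u) auto
  qed
qed

text \<open>Here \<open>(a, c)\<close> and \<open>(b, d)\<close> are the images of the two unit
  vectors, so the four candidates for \<open>r\<close> are those of the standard position, carried
  along.\<close>

lemma unit_pair:
  assumes E: "local_spanner E" and sp: "signed_perm a b c d"
  shows "{(s, t), (s + a, t + c)} \<in> E \<or>
    (\<exists>r \<in> {(s + b, t + d), (s - b, t - d), (s + a + b, t + c + d), (s + a - b, t + c - d)}.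
       {(s, t), r} \<in> E \<and> {r, (s + a, t + c)} \<in> E)"
  using unit_pair_origin[OF local_spanner_pull[OF E sp, of s t]]
  by (simp add: frame_def algebra_simps)

section \<open>Exclusion of long edges\<close>

lemma degree_le_3:
  assumes E: "local_spanner E" and "distinct [a, b, c, d]"
    and "{v, a} \<in> E" "{v, b} \<in> E" "{v, c} \<in> E" "{v, d} \<in> E"
  shows False
proof -
  let ?S = "{{v, a}, {v, b}, {v, c}, {v, d}}"
  have "card ?S = 4"
    using assms(2) by (simp add: doubleton_eq_iff card_insert_if)
  moreover have "card ?S \<le> card {e \<in> E. v \<in> e}"
    using assms by (intro card_mono local_spannerD(3)) auto
  ultimately show False
    using local_spannerD(4)[OF E, of v] by simp
qed

lemma no_crossing:
  assumes "local_spanner E" "{u, v} \<in> E" "{w, x} \<in> E" "{u, v} \<noteq> {w, x}"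
    and "z \<in> closed_segment (pt u) (pt v)" "z \<in> closed_segment (pt w) (pt x)"
  shows "z \<in> pt ` ({u, v} \<inter> {w, x})"
  using local_spannerD(2)[OF assms(1-4)] assms(5,6) by blast

lemma in_segment_pt:
  assumes "0 \<le> r" "r \<le> 1" "x = (1 - r) * real_of_int a + r * real_of_int c" "y = (1 - r) * real_of_int b + r * real_of_int d"
  shows "(x, y) \<in> closed_segment (pt (a, b)) (pt (c, d))"
  using assms by (auto simp: closed_segment_def pt_def intro!: exI[of _ r])

text \<open>A longer edge would pass through or strictly between \<open>(1, 0)\<close> and
  \<open>(1, 1)\<close>. Any admissible connection of these two points then crosses it, or runs
  through one of its ends and gives that end a fourth neighbour.\<close>

lemma edge_short_origin:
  assumes E: "local_spanner E" and e: "{(0, 0), (a, b)} \<in> E" and ab: "0 \<le> b" "b \<le> a"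
  shows "a \<le> 1"
proof (rule ccontr)
  assume "\<not> a \<le> 1"
  then have a: "2 \<le> a"
    by simp
  have cross: False
    if "{w, x} \<in> E" "(r * a, r * b) \<in> closed_segment (pt w) (pt x)" "0 \<le> r" "r \<le> 1"
      "w \<notin> {(0, 0), (a, b)}" "x \<notin> {(0, 0), (a, b)}" for w x and r :: real
  proof -
    have "(r * a, r * b) \<in> closed_segment (pt (0, 0)) (pt (a, b))"
      by (rule in_segment_pt[of r]) (use that in simp_all)
    moreover have "{(0, 0), (a, b)} \<noteq> {w, x}" "{(0, 0), (a, b)} \<inter> {w, x} = {}"
      using that by auto
    ultimately show False
      using no_crossing[OF E e that(1) _ _ that(2)] by simp
  qed
  \<comment> \<open>A lattice point on the long edge other than its ends can have no incident edge,
    but every vertex needs one to reach its neighbours.\<close>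
  have vertex: False
    if "{w, x} \<in> E" "pt w = (r * a, r * b)" "0 \<le> r" "r \<le> 1" "w \<notin> {(0, 0), (a, b)}" for w x and r :: real
  proof -
    have "(r * a, r * b) \<in> closed_segment (pt (0, 0)) (pt (a, b))"
      by (rule in_segment_pt[of r]) (use that in simp_all)
    moreover have "{(0, 0), (a, b)} \<noteq> {w, x}" "pt w \<notin> pt ` ({(0, 0), (a, b)} \<inter> {w, x})"
      using that(5) inj_pt by (auto simp: inj_image_mem_iff)
    ultimately show False
      using no_crossing[OF E e that(1), of "pt w"] that(2) by simp
  qed
  have pair: "{(1, 0), (1, 1)} \<in> E \<or>
      (\<exists>r \<in> {(2, 0), (0, 0), (2, 1), (0, 1)}. {(1, 0), r} \<in> E \<and> {r, (1, 1)} \<in> E)"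
    using unit_pair[OF E, of 0 1 1 0 1 0] by (simp add: signed_perm_def)
  moreover have swap: "{v, u} \<in> E" if "{u, v} \<in> E" for u v
    using that by (simp add: insert_commute)
  ultimately have "(\<exists>w. {(1, 0), w} \<in> E) \<and> (\<exists>x. {(1, 1), x} \<in> E)"
    by blast
  then obtain w x where wx: "{(1, 0), w} \<in> E" "{(1, 1), x} \<in> E"
    by blast
  have "b \<noteq> 0"
    using vertex[OF wx(1), of "1 / a"] a by (auto simp: pt_def)
  moreover have "b \<noteq> a"
    using vertex[OF wx(2), of "1 / a"] a by (auto simp: pt_def)
  ultimately have b: "0 < b" "b < a"
    using ab by auto
  then have pos: "0 < real_of_int a" "0 < real_of_int b" "0 < real_of_int a + real_of_int b"
      "0 < real_of_int a - real_of_int b" "real_of_int a + real_of_int b \<noteq> 0"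
      "real_of_int a - real_of_int b \<noteq> 0"
    by auto
  from pair consider "{(1, 0), (1, 1)} \<in> E"
    | "{(1, 0), (2, 0)} \<in> E" "{(2, 0), (1, 1)} \<in> E"
    | "{(1, 0), (0, 0)} \<in> E" "{(0, 0), (1, 1)} \<in> E"
    | "{(1, 0), (2, 1)} \<in> E" "{(2, 1), (1, 1)} \<in> E"
    | "{(1, 0), (0, 1)} \<in> E" "{(0, 1), (1, 1)} \<in> E"
    by auto
  then show False
  proof cases
    case 1
    have "(1 / a * a, 1 / a * b) \<in> closed_segment (pt (1, 0)) (pt (1, 1))"
      by (rule in_segment_pt[of "b / a"]) (use a b pos in \<open>simp_all add: field_simps\<close>)
    then show False
      by (rule cross[OF 1]) (use a b in auto)
  next
    case 2
    \<comment> \<open>Parameter at which the long edge meets the line \<open>x + y = 2\<close>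
      through \<open>(2, 0)\<close> and \<open>(1, 1)\<close>. In the cases below \<open>r\<close>
      is likewise the parameter on the line carrying the crossed edge.\<close>
    define r where "r = 2 / (real_of_int a + real_of_int b)"
    have "0 < r" "r \<le> 1"
      using a b pos by (simp_all add: r_def)
    moreover have "r * (a + b) = 2"
      using r_def nonzero_eq_divide_eq[OF pos(5)] by simp
    ultimately have r: "0 \<le> r" "r \<le> 1" "r * a + r * b = 2" "0 < r * b" "r * b < r * a"
      using b by (simp_all add: distrib_left)
    have "(r * a, r * b) \<in> closed_segment (pt (2, 0)) (pt (1, 1))"
      by (rule in_segment_pt[of "r * b"]) (use r in \<open>simp_all add: algebra_simps\<close>)
    then show False
      by (rule cross[OF 2(2)]) (use r a b in auto)
  next
    case 3
    \<comment> \<open>The unit pair of the origin and \<open>(-1, 0)\<close> supplies a neighbour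
      distinct from \<open>(1, 0)\<close>, \<open>(1, 1)\<close> and \<open>(a, b)\<close>: a fourth
      one at the origin.\<close>
    have "\<exists>r \<in> {(-1, 0), (0, -1), (0, 1), (-1, -1), (-1, 1)}. {(0, 0), r} \<in> E"
      using unit_pair[OF E, of "-1" 0 0 "-1" 0 0] by (auto simp: signed_perm_def)
    then obtain r where r: "r \<in> {(-1, 0), (0, -1), (0, 1), (-1, -1), (-1, 1)}" "{(0, 0), r} \<in> E"
      by (rule bexE)
    have "distinct [(1, 0), (1, 1), (a, b), r]"
      using r(1) a by (elim insertE emptyE) simp_all
    from degree_le_3[OF E this swap[OF 3(1)] 3(2) e r(2)] show False .
  next
    case 4
    show False
    \<comment> \<open>The slope decides which edge at \<open>(2, 1)\<close> is crossed: the one to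
      \<open>(1, 1)\<close> if the long edge passes above \<open>(2, 1)\<close>, otherwise the one
      to \<open>(1, 0)\<close>, unless the long edge ends at \<open>(2, 1)\<close>, where the degree
      is exceeded.\<close>
    proof (cases "a < 2 * b")
      case True
      have "(1 / b * a, 1 / b * b) \<in> closed_segment (pt (2, 1)) (pt (1, 1))"
        by (rule in_segment_pt[of "2 - a / b"]) (use True a b pos in \<open>simp_all add: field_simps\<close>)
      then show False
        by (rule cross[OF 4(2)]) (use True a b in auto)
    next
      case False
      show False
      proof (cases "a = 2")
        case True
        then have "b = 1"
          using b by simp
        with True e have ab': "{(2, 1), (0, 0)} \<in> E"
          by (simp add: insert_commute)
        have "\<exists>r \<in> {(3, 1), (2, 2), (2, 0), (3, 2), (3, 0)}. {(2, 1), r} \<in> E"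
          using unit_pair[OF E, of 1 0 0 1 2 1] by (auto simp: signed_perm_def)
        then obtain r where r: "r \<in> {(3, 1), (2, 2), (2, 0), (3, 2), (3, 0)}" "{(2, 1), r} \<in> E"
          by (rule bexE)
        have "distinct [(1, 0), (1, 1), (0, 0), r]"
          using r(1) by (elim insertE emptyE) simp_all
        from degree_le_3[OF E this swap[OF 4(1)] 4(2) ab' r(2)] show False .
      next
        case neq: False
        define r where "r = 1 / (real_of_int a - real_of_int b)"
        have "0 < r" "r \<le> 1" "r * b \<le> 1"
          using False a b pos by (simp_all add: r_def)
        moreover have "r * (a - b) = 1"
          using r_def nonzero_eq_divide_eq[OF pos(6)] by simp
        ultimately have r: "0 \<le> r" "r \<le> 1" "r * a - r * b = 1" "0 < r * b" "r * b \<le> 1"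
          using b by (simp_all add: right_diff_distrib)
        have "(r * a, r * b) \<in> closed_segment (pt (1, 0)) (pt (2, 1))"
          by (rule in_segment_pt[of "r * b"]) (use r in \<open>simp_all add: algebra_simps\<close>)
        then show False
          by (rule cross[OF 4(1)]) (use r neq a b in auto)
      qed
    qed
  next
    case 5
    define r where "r = 1 / (real_of_int a + real_of_int b)"
    have "0 < r" "r \<le> 1"
      using a b pos by (simp_all add: r_def)
    moreover have "r * (a + b) = 1"
      using r_def nonzero_eq_divide_eq[OF pos(5)] by simp
    ultimately have r: "0 \<le> r" "r \<le> 1" "r * a + r * b = 1" "0 < r * b" "r * b < r * a"
      using b by (simp_all add: distrib_left)
    have "(r * a, r * b) \<in> closed_segment (pt (1, 0)) (pt (0, 1))"
      by (rule in_segment_pt[of "r * b"]) (use r in \<open>simp_all add: algebra_simps\<close>)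
    then show False
      by (rule cross[OF 5(1)]) (use r a b in auto)
  qed
qed

lemma edge_short:
  assumes E: "local_spanner E" and e: "{(x, y), (x', y')} \<in> E"
  shows "\<bar>x' - x\<bar> \<le> 1 \<and> \<bar>y' - y\<bar> \<le> 1"
proof -
  obtain a b c d u v where uv: "0 \<le> v" "v \<le> u" and sp: "signed_perm a b c d"
    and xy: "x' - x = a * u + b * v" "y' - y = c * u + d * v"
    by (rule lattice_orientation)
  have "frame a b c d x y (u, v) = (x', y')"
    using xy by (simp add: frame_def)
  then have "{(0, 0), (u, v)} \<in> pull (frame a b c d x y) E"
    using e by (simp add: frame_def)
  then have "u \<le> 1"
    using edge_short_origin[OF local_spanner_pull[OF E sp]] uv by blast
  with uv have "u \<in> {0, 1}" "v \<in> {0, 1}"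
    by auto
  then show ?thesis
    using xy sp by (auto simp: signed_perm_def)
qed

subsection \<open>Unit and diagonal edges\<close>

definition adj :: "edges \<Rightarrow> vertex \<Rightarrow> vertex \<Rightarrow> bool" where
  "adj E u v \<longleftrightarrow> {u, v} \<in> E"

text \<open>Each edge gets a single name, indexed by the lower left corner of its bounding box. For
  \<open>anti\<close>, the falling diagonal, that corner is not an end point.\<close>

definition hor :: "edges \<Rightarrow> int \<Rightarrow> int \<Rightarrow> bool" where "hor E x y \<longleftrightarrow> adj E (x, y) (x + 1, y)"
definition ver :: "edges \<Rightarrow> int \<Rightarrow> int \<Rightarrow> bool" where "ver E x y \<longleftrightarrow> adj E (x, y) (x, y + 1)"
definition dia :: "edges \<Rightarrow> int \<Rightarrow> int \<Rightarrow> bool" where "dia E x y \<longleftrightarrow> adj E (x, y) (x + 1, y + 1)"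
definition anti :: "edges \<Rightarrow> int \<Rightarrow> int \<Rightarrow> bool" where "anti E x y \<longleftrightarrow> adj E (x + 1, y) (x, y + 1)"

lemma adj_sym: "adj E u v = adj E v u"
  by (simp add: adj_def insert_commute)

text \<open>Normal form for adjacency of lattice neighbours: the order of the end points disappears,
  so the same edge always yields the same atom.\<close>

lemma adj_cases:
  "x' = x + 1 \<Longrightarrow> y' = y \<Longrightarrow> adj E (x, y) (x', y') = hor E x y"
  "x = x' + 1 \<Longrightarrow> y' = y \<Longrightarrow> adj E (x, y) (x', y') = hor E x' y"
  "x' = x \<Longrightarrow> y' = y + 1 \<Longrightarrow> adj E (x, y) (x', y') = ver E x y"
  "x' = x \<Longrightarrow> y = y' + 1 \<Longrightarrow> adj E (x, y) (x', y') = ver E x y'"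
  "x' = x + 1 \<Longrightarrow> y' = y + 1 \<Longrightarrow> adj E (x, y) (x', y') = dia E x y"
  "x = x' + 1 \<Longrightarrow> y = y' + 1 \<Longrightarrow> adj E (x, y) (x', y') = dia E x' y'"
  "x = x' + 1 \<Longrightarrow> y' = y + 1 \<Longrightarrow> adj E (x, y) (x', y') = anti E x' y"
  "x' = x + 1 \<Longrightarrow> y = y' + 1 \<Longrightarrow> adj E (x, y) (x', y') = anti E x y'"
  by (auto simp: hor_def ver_def dia_def anti_def adj_sym)

text \<open>The eight propositions are halved into \<open>a\<close> to \<open>d\<close> and
  \<open>e\<close> to \<open>h\<close>, and the splits 4+0, 0+4, 3+1, 2+2 and 1+3 are excluded. This
  is far smaller than listing all 70 quadruples.\<close>

definition at_most_3 :: "bool \<Rightarrow> bool \<Rightarrow> bool \<Rightarrow> bool \<Rightarrow> bool \<Rightarrow> bool \<Rightarrow> bool \<Rightarrow> bool \<Rightarrow> bool" where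
  "at_most_3 a b c d e f g h \<longleftrightarrow>
     \<not> (a \<and> b \<and> c \<and> d) \<and> \<not> (e \<and> f \<and> g \<and> h) \<and>
     \<not> ((a \<and> b \<and> (c \<or> d) \<or> c \<and> d \<and> (a \<or> b)) \<and> (e \<or> f \<or> g \<or> h)) \<and>
     \<not> ((a \<and> b \<or> c \<and> d \<or> (a \<or> b) \<and> (c \<or> d)) \<and> (e \<and> f \<or> g \<and> h \<or> (e \<or> f) \<and> (g \<or> h))) \<and>
     \<not> ((a \<or> b \<or> c \<or> d) \<and> (e \<and> f \<and> (g \<or> h) \<or> g \<and> h \<and> (e \<or> f)))"

text \<open>\<open>route k E m [] x y x' y'\<close> says that a path of \<open>k\<close> edges, \<open>m\<close> of them diagonal, leads from
  \<open>(x, y)\<close> to \<open>(x', y')\<close>; \<open>vs\<close> are the vertices already visited. The tests on the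
  displacement are redundant: they prune the search when the simplifier expands the predicate, for
  numerals, into a propositional formula over the edges.\<close>

primrec route :: "nat \<Rightarrow> edges \<Rightarrow> nat \<Rightarrow> vertex list \<Rightarrow> int \<Rightarrow> int \<Rightarrow> int \<Rightarrow> int \<Rightarrow> bool" where
  "route 0 E m vs x y x' y' \<longleftrightarrow> m = 0 \<and> x = x' \<and> y = y' \<and> (x, y) \<notin> set vs"
| "route (Suc k) E m vs x y x' y' \<longleftrightarrow>
    (if 1 + int k < \<bar>x' - x\<bar> \<or> 1 + int k < \<bar>y' - y\<bar>
        \<or> 1 + int k + int m < \<bar>x' - x\<bar> + \<bar>y' - y\<bar> \<or> (1 + int k + int m + x' - x + y' - y) mod 2 = 1
        \<or> (x, y) \<in> set vs then False
     else  (hor E x y \<and> route k E m ((x, y) # vs) (x + 1) y x' y'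
           \<or> hor E (x - 1) y \<and> route k E m ((x, y) # vs) (x - 1) y x' y'
           \<or> ver E x y \<and> route k E m ((x, y) # vs) x (y + 1) x' y'
           \<or> ver E x (y - 1) \<and> route k E m ((x, y) # vs) x (y - 1) x' y')
        \<or> (if m = 0 then False else
             dia E x y \<and> route k E (m - 1) ((x, y) # vs) (x + 1) (y + 1) x' y'
           \<or> dia E (x - 1) (y - 1) \<and> route k E (m - 1) ((x, y) # vs) (x - 1) (y - 1) x' y'
           \<or> anti E x (y - 1) \<and> route k E (m - 1) ((x, y) # vs) (x + 1) (y - 1) x' y'
           \<or> anti E (x - 1) y \<and> route k E (m - 1) ((x, y) # vs) (x - 1) (y + 1) x' y'))"

text \<open>For a knight's move, these are all the possibilities with \<open>k - m + m * sqrt 2 \<le> 3 + sqrt 2\<close>.\<close>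

definition short :: "edges \<Rightarrow> int \<Rightarrow> int \<Rightarrow> int \<Rightarrow> int \<Rightarrow> bool" where
  "short E x y x' y' \<longleftrightarrow> (\<exists>(k, m) \<in> {(2, 1), (3, 2), (3, 0), (4, 1)}. route k E m [] x y x' y')"

section \<open>Correspondence between routes and paths\<close>

lemma route_bounds:
  assumes "route k E m vs x y x' y'"
  shows "\<bar>x' - x\<bar> \<le> int k" "\<bar>y' - y\<bar> \<le> int k" "\<bar>x' - x\<bar> + \<bar>y' - y\<bar> \<le> int k + int m"
    "(int k + int m + x' - x + y' - y) mod 2 = 0"
  using assms by (cases k; auto split: if_splits)+

lemma route_imp_walk:
  assumes "route k E m vs x y x' y'"
  shows "m \<le> k \<and> walk E (x, y) (x', y') (real (k - m) + real m * sqrt 2)"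
  using assms
proof (induction k arbitrary: m vs x y)
  case 0
  then show ?case by (simp add: walk_refl)
next
  case (Suc k)
  have edge: "walk E (x, y) (x', y') M"
    if "adj E (x, y) (u, v)" "walk E (u, v) (x', y') L" "dist (pt (x, y)) (pt (u, v)) + L = M" for u v L M
    unfolding that(3)[symmetric]
  proof (rule walk_trans[OF _ that(2)])
    show "walk E (x, y) (u, v) (dist (pt (x, y)) (pt (u, v)))"
      unfolding walk_def using that(1) by (intro exI[of _ "[(x, y), (u, v)]"]) (simp add: adj_def)
  qed
  have unit: ?case
    if "adj E (x, y) (u, v)" "dist (pt (x, y)) (pt (u, v)) = 1" "route k E m ((x, y) # vs) u v x' y'" for u v
  proof -
    from Suc.IH[OF that(3)] have m: "m \<le> k" and w: "walk E (u, v) (x', y') (real (k - m) + real m * sqrt 2)"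
      by blast+
    show ?thesis
      using m by (auto intro!: edge[OF that(1) w] simp: that(2) of_nat_diff)
  qed
  have diagonal: ?case
    if "adj E (x, y) (u, v)" "dist (pt (x, y)) (pt (u, v)) = sqrt 2" "m \<noteq> 0" "route k E (m - 1) ((x, y) # vs) u v x' y'" for u v
  proof -
    from Suc.IH[OF that(4)] have m: "m - 1 \<le> k" and w: "walk E (u, v) (x', y') (real (k - (m - 1)) + real (m - 1) * sqrt 2)"
      by blast+
    show ?thesis
      using m that(3) by (auto intro!: edge[OF that(1) w] simp: that(2) of_nat_diff algebra_simps)
  qed
  from Suc.prems consider
      "hor E x y" "route k E m ((x, y) # vs) (x + 1) y x' y'"
    | "hor E (x - 1) y" "route k E m ((x, y) # vs) (x - 1) y x' y'"
    | "ver E x y" "route k E m ((x, y) # vs) x (y + 1) x' y'"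
    | "ver E x (y - 1)" "route k E m ((x, y) # vs) x (y - 1) x' y'"
    | "dia E x y" "m \<noteq> 0" "route k E (m - 1) ((x, y) # vs) (x + 1) (y + 1) x' y'"
    | "dia E (x - 1) (y - 1)" "m \<noteq> 0" "route k E (m - 1) ((x, y) # vs) (x - 1) (y - 1) x' y'"
    | "anti E x (y - 1)" "m \<noteq> 0" "route k E (m - 1) ((x, y) # vs) (x + 1) (y - 1) x' y'"
    | "anti E (x - 1) y" "m \<noteq> 0" "route k E (m - 1) ((x, y) # vs) (x - 1) (y + 1) x' y'"
    unfolding route.simps by (simp split: if_split_asm) blast+
  then show ?case
  proof cases
    case 1 then show ?thesis by (intro unit[of "x + 1" y]) (simp_all add: adj_cases dist_pt)
  next
    case 2 then show ?thesis by (intro unit[of "x - 1" y]) (simp_all add: adj_cases dist_pt)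
  next
    case 3 then show ?thesis by (intro unit[of x "y + 1"]) (simp_all add: adj_cases dist_pt)
  next
    case 4 then show ?thesis by (intro unit[of x "y - 1"]) (simp_all add: adj_cases dist_pt)
  next
    case 5 then show ?thesis by (intro diagonal[of "x + 1" "y + 1"]) (simp_all add: adj_cases dist_pt)
  next
    case 6 then show ?thesis by (intro diagonal[of "x - 1" "y - 1"]) (simp_all add: adj_cases dist_pt)
  next
    case 7 then show ?thesis by (intro diagonal[of "x + 1" "y - 1"]) (simp_all add: adj_cases dist_pt)
  next
    case 8 then show ?thesis by (intro diagonal[of "x - 1" "y + 1"]) (simp_all add: adj_cases dist_pt)
  qed
qed

text \<open>The bounds and the parity of the shorter route, shifted by one step, are the tests of
  the longer one. So the pruning in \<open>route\<close> never rejects an actual path.\<close>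

lemma route_step:
  assumes r: "route k E m ((x, y) # vs) u v x' y'" and e: "adj E (x, y) (u, v)" and xy: "(x, y) \<notin> set vs"
  shows "\<bar>u - x\<bar> + \<bar>v - y\<bar> = 1 \<Longrightarrow> route (Suc k) E m vs x y x' y'"
    and "\<bar>u - x\<bar> = 1 \<Longrightarrow> \<bar>v - y\<bar> = 1 \<Longrightarrow> route (Suc k) E (Suc m) vs x y x' y'"
proof -
  note b = route_bounds[OF r]
  assume uv: "\<bar>u - x\<bar> + \<bar>v - y\<bar> = 1"
  then have "\<bar>x' - x\<bar> \<le> 1 + int k" "\<bar>y' - y\<bar> \<le> 1 + int k" "\<bar>x' - x\<bar> + \<bar>y' - y\<bar> \<le> 1 + int k + int m"
    using b by linarith+
  moreover have "(1 + int k + int m + x' - x + y' - y) mod 2 \<noteq> 1"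
    using b(4) uv by presburger
  ultimately have guard: "\<not> (1 + int k < \<bar>x' - x\<bar> \<or> 1 + int k < \<bar>y' - y\<bar>
        \<or> 1 + int k + int m < \<bar>x' - x\<bar> + \<bar>y' - y\<bar> \<or> (1 + int k + int m + x' - x + y' - y) mod 2 = 1
        \<or> (x, y) \<in> set vs)"
    using xy by linarith
  have "u = x + 1 \<and> v = y \<or> u = x - 1 \<and> v = y \<or> u = x \<and> v = y + 1 \<or> u = x \<and> v = y - 1"
    using uv by presburger
  then show "route (Suc k) E m vs x y x' y'"
    unfolding route.simps if_not_P[OF guard] using r e by (elim disjE conjE) (simp_all add: adj_cases)
next
  note b = route_bounds[OF r]
  assume uv: "\<bar>u - x\<bar> = 1" "\<bar>v - y\<bar> = 1"
  then have "\<bar>x' - x\<bar> \<le> 1 + int k" "\<bar>y' - y\<bar> \<le> 1 + int k" "\<bar>x' - x\<bar> + \<bar>y' - y\<bar> \<le> 1 + int k + int (Suc m)"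
    using b by linarith+
  moreover have "(1 + int k + int (Suc m) + x' - x + y' - y) mod 2 \<noteq> 1"
    using b(4) uv by presburger
  ultimately have guard: "\<not> (1 + int k < \<bar>x' - x\<bar> \<or> 1 + int k < \<bar>y' - y\<bar>
        \<or> 1 + int k + int (Suc m) < \<bar>x' - x\<bar> + \<bar>y' - y\<bar> \<or> (1 + int k + int (Suc m) + x' - x + y' - y) mod 2 = 1
        \<or> (x, y) \<in> set vs)"
    using xy by linarith
  have "u = x + 1 \<and> v = y + 1 \<or> u = x + 1 \<and> v = y - 1 \<or> u = x - 1 \<and> v = y + 1 \<or> u = x - 1 \<and> v = y - 1"
    using uv by presburger
  then show "route (Suc k) E (Suc m) vs x y x' y'"
    unfolding route.simps if_not_P[OF guard] using r e by (elim disjE conjE) (simp_all add: adj_cases)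
qed

text \<open>By \<open>edge_short\<close> every edge is unit or diagonal, and \<open>m\<close> counts
  the diagonal ones. The list \<open>vs\<close> is arbitrary so that the induction can record the
  vertices already left behind.\<close>

lemma path_imp_route:
  assumes E: "local_spanner E"
    and "successively (\<lambda>u v. {u, v} \<in> E) ((x, y) # ps)" "distinct ((x, y) # ps)"
    and "last ((x, y) # ps) = (x', y')" "set vs \<inter> set ((x, y) # ps) = {}"
  shows "\<exists>m \<le> length ps. route (length ps) E m vs x y x' y' \<and>
    path_len ((x, y) # ps) = real (length ps - m) + real m * sqrt 2"
  using assms(2-)
proof (induction ps arbitrary: x y vs)
  case Nil
  then show ?case by auto
next
  case (Cons p ps)
  obtain u v where p: "p = (u, v)"
    by fastforce
  have e: "{(x, y), (u, v)} \<in> E"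
    using Cons.prems p by simp
  obtain m where m: "m \<le> length ps" "route (length ps) E m ((x, y) # vs) u v x' y'"
    "path_len ((u, v) # ps) = real (length ps - m) + real m * sqrt 2"
    using Cons.IH[of u v "(x, y) # vs"] Cons.prems p by auto
  have uv: "\<bar>u - x\<bar> \<le> 1" "\<bar>v - y\<bar> \<le> 1" "(u, v) \<noteq> (x, y)"
    using edge_short[OF E e] Cons.prems p by auto
  have xy: "(x, y) \<notin> set vs"
    using Cons.prems by auto
  note step = route_step[OF m(2) _ xy, unfolded adj_def, OF e]
  show ?case
  proof (cases "u = x \<or> v = y")
    case True
    then have d: "\<bar>u - x\<bar> + \<bar>v - y\<bar> = 1"
      using uv by auto
    then have "(x - u)\<^sup>2 + (y - v)\<^sup>2 = 1"
      using True by (auto simp: power2_eq_1_iff)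
    then have "dist (pt (x, y)) (pt (u, v)) = 1"
      unfolding dist_pt by (simp flip: of_int_diff of_int_power of_int_add)
    then show ?thesis
      using m p step(1)[OF d] by (intro exI[of _ m]) (simp add: Suc_diff_le)
  next
    case False
    then have d: "\<bar>u - x\<bar> = 1" "\<bar>v - y\<bar> = 1"
      using uv by auto
    then have "(x - u)\<^sup>2 = 1" "(y - v)\<^sup>2 = 1"
      by (simp_all add: power2_eq_1_iff abs_if split: if_splits)
    then have "dist (pt (x, y)) (pt (u, v)) = sqrt 2"
      unfolding dist_pt by (simp flip: of_int_diff of_int_power of_int_add)
    then show ?thesis
      using m p step(2)[OF d] by (intro exI[of _ "Suc m"]) (simp add: algebra_simps)
  qed
qed

lemma reaches_imp_route:
  assumes E: "local_spanner E" and r: "reaches E (x, y) (x', y') L"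
  shows "\<exists>k m. m \<le> k \<and> route k E m [] x y x' y' \<and> real (k - m) + real m * sqrt 2 \<le> L"
proof -
  obtain xs where xs: "graph_path E (x, y) (x', y') xs" "path_len xs \<le> L"
    using r by (auto simp: reaches_def)
  then obtain ps where ps: "xs = (x, y) # ps"
    by (cases xs) (auto simp: graph_path_def)
  have "\<exists>m \<le> length ps. route (length ps) E m [] x y x' y' \<and>
      path_len ((x, y) # ps) = real (length ps - m) + real m * sqrt 2"
    by (rule path_imp_route[OF E]) (use xs(1) in \<open>simp_all add: graph_path_def ps\<close>)
  then obtain m where "m \<le> length ps" "route (length ps) E m [] x y x' y'"
      "path_len ((x, y) # ps) = real (length ps - m) + real m * sqrt 2"
    by blast
  with xs(2) show ?thesis
    unfolding ps by metis
qed

lemma short_imp_reaches: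
  assumes "short E x y x' y'"
  shows "reaches E (x, y) (x', y') (3 + sqrt 2)"
proof -
  have "1 \<le> sqrt 2" "sqrt 2 \<le> 2"
    by (simp_all add: real_le_lsqrt)
  with assms show ?thesis
    unfolding short_def
    by (auto dest!: route_imp_walk intro!: walk_imp_reaches elim!: walk_mono)
qed

section \<open>Admissible routes for a knight's move\<close>

lemma sqrt2_bounds: "1.414 < sqrt (2::real)" "sqrt (2::real) < 1.4143"
  by (rule real_less_rsqrt, simp add: power2_eq_square) (rule real_less_lsqrt, simp_all add: power2_eq_square)

text \<open>The number \<open>n\<close> of unit edges is odd because the displacement has odd
  coordinate sum, and \<open>n + 2 * m\<close> is at least 3. The bound 5.4, slightly above
  \<open>(1 + sqrt 2) * sqrt 5\<close>, then leaves six pairs.\<close>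

lemma knight_route:
  fixes k m :: nat
  assumes "route k E m [] x y x' y'" "m \<le> k" "\<bar>x' - x\<bar> + \<bar>y' - y\<bar> = 3" "\<bar>x' - x\<bar> \<le> 2" "\<bar>y' - y\<bar> \<le> 2"
    and len: "real (k - m) + real m * sqrt 2 < 5.4"
  shows "(k, m) \<in> {(2, 1), (3, 2), (3, 0), (4, 1), (5, 0), (4, 3)}"
proof -
  obtain n where k: "k = n + m"
    using \<open>m \<le> k\<close> by (metis le_add_diff_inverse2)
  have "real n + real m * 1.414 < 5.4"
    using len mult_left_mono[of "1.414" "sqrt 2" "real m"] sqrt2_bounds by (simp add: k)
  then have "real (1000 * n + 1414 * m) < real 5400"
    by simp
  then have nm: "1000 * n + 1414 * m < 5400"
    by (simp only: of_nat_less_iff)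
  have "odd n" "3 \<le> n + 2 * m"
    using route_bounds(3,4)[OF assms(1)] assms(3) unfolding k by presburger+
  moreover from nm have "m = 0 \<or> m = 1 \<or> m = 2 \<or> m = 3" "n < 6"
    by linarith+
  moreover from \<open>n < 6\<close> \<open>odd n\<close> have "n = 1 \<or> n = 3 \<or> n = 5"
    by presburger
  ultimately show ?thesis
    using nm unfolding k by (elim disjE) simp_all
qed

text \<open>Of the six possible routes, the two missing from \<open>short\<close> have lengths 5 and
  \<open>1 + 3 * sqrt 2\<close>, both above \<open>3 + sqrt 2\<close>. Thus \<open>short\<close>
  captures this length bound exactly for knight's moves.\<close>

lemma reaches_imp_short:
  assumes E: "local_spanner E" and r: "reaches E (x, y) (x', y') (3 + sqrt 2)"
    and d: "\<bar>x' - x\<bar> + \<bar>y' - y\<bar> = 3" "\<bar>x' - x\<bar> \<le> 2" "\<bar>y' - y\<bar> \<le> 2"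
  shows "short E x y x' y'"
proof -
  obtain k m where km: "m \<le> k" "route k E m [] x y x' y'" "real (k - m) + real m * sqrt 2 \<le> 3 + sqrt 2"
    using reaches_imp_route[OF E r] by blast
  then have "(k, m) \<in> {(2, 1), (3, 2), (3, 0), (4, 1), (5, 0), (4, 3)}"
    using sqrt2_bounds by (intro knight_route[OF km(2,1) d]) auto
  moreover have "(k, m) \<noteq> (5, 0)" "(k, m) \<noteq> (4, 3)"
    using km(3) sqrt2_bounds by force+
  ultimately show ?thesis
    using km(2) unfolding short_def by auto
qed

lemma knight_cases:
  assumes E: "local_spanner E"
  shows "short E (-1) 0 1 1 \<or> route 5 E 0 [] (-1) 0 1 1 \<or> route 4 E 3 [] (-1) 0 1 1"
proof -
  have d: "dist (pt (-1, 0)) (pt (1, 1)) = sqrt 5"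
    by (simp add: dist_pt)
  have "((1 + sqrt 2) * sqrt 5)\<^sup>2 < (5.4::real)\<^sup>2"
    using sqrt2_bounds by (simp add: power_mult_distrib power2_sum) (simp add: power2_eq_square)
  then have "(1 + sqrt 2) * sqrt 5 < (5.4::real)"
    by (rule power_less_imp_less_base) simp
  moreover obtain k m where km: "m \<le> k" "route k E m [] (-1) 0 1 1"
      "real (k - m) + real m * sqrt 2 \<le> (1 + sqrt 2) * sqrt 5"
  proof -
    have "reaches E (-1, 0) (1, 1) ((1 + sqrt 2) * sqrt 5)"
      using local_spannerD(5)[OF E, of "(-1, 0)" "(1, 1)"] d by simp
    from reaches_imp_route[OF E this] that show ?thesis
      by blast
  qed
  ultimately have "(k, m) \<in> {(2, 1), (3, 2), (3, 0), (4, 1), (5, 0), (4, 3)}"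
    by (intro knight_route[OF km(2,1)]) auto
  then show ?thesis
    using km(2) unfolding short_def by auto
qed

lemma path_len_rev: "path_len (rev xs) = path_len xs"
proof (induction xs rule: induct_list012)
  case (3 x y zs)
  then show ?case
    using path_len_append[of "rev zs" y "[x]"] by (simp add: dist_commute)
qed simp_all

lemma reaches_sym:
  assumes "reaches E p q L"
  shows "reaches E q p L"
proof -
  obtain xs where xs: "graph_path E p q xs" "path_len xs \<le> L"
    using assms by (auto simp: reaches_def)
  then have "graph_path E q p (rev xs)"
    by (auto simp: graph_path_def hd_rev last_rev insert_commute)
  with xs show ?thesis
    by (auto simp: reaches_def path_len_rev)
qed

lemma reaches_pull:
  assumes r: "reaches (pull (frame a b c d s t) E) p q L" and sp: "signed_perm a b c d"
  shows "reaches E (frame a b c d s t p) (frame a b c d s t q) L"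
proof -
  let ?T = "frame a b c d s t"
  have inj: "inj ?T"
    using bij_frame[OF sp] by (simp add: bij_def)
  obtain xs where xs: "graph_path (pull ?T E) p q xs" "path_len xs \<le> L"
    using r by (auto simp: reaches_def)
  then have "graph_path E (?T p) (?T q) (map ?T xs)"
    using inj by (auto simp: graph_path_def hd_map last_map distinct_map successively_map intro: inj_on_subset)
  moreover have "path_len (map ?T zs) = path_len zs" for zs
    by (induction zs rule: induct_list012) (auto simp: dist_frame[OF sp])
  ultimately show ?thesis
    using xs(2) unfolding reaches_def by auto
qed

lemma successively_adj_pull: "successively (adj (pull T E)) ps \<longleftrightarrow> successively (adj E) (map T ps)"
  by (simp add: successively_map adj_def[abs_def])

text \<open>The transport passes through \<open>reaches\<close>, which is invariant under
  isometries, whereas the route formulas depend on the orientation.\<close>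

lemma short_pull:
  assumes E: "local_spanner E" and sp: "signed_perm a b c d"
    and "short (pull (frame a b c d s t) E) (-1) 0 1 1"
  shows "short E (s - a) (t - c) (s + a + b) (t + c + d)"
proof (rule reaches_imp_short[OF E])
  show "reaches E (s - a, t - c) (s + a + b, t + c + d) (3 + sqrt 2)"
    using reaches_pull[OF short_imp_reaches[OF assms(3)] sp] by (simp add: frame_def algebra_simps)
qed (use sp in \<open>auto simp: signed_perm_def\<close>)

section \<open>Local conditions as propositional formulas over edges\<close>

lemma vertex_degree:
  assumes E: "local_spanner E"
  shows "at_most_3 (hor E x y) (dia E x y) (ver E x y) (anti E (x - 1) y)
     (hor E (x - 1) y) (dia E (x - 1) (y - 1)) (ver E x (y - 1)) (anti E x (y - 1))"
proof -
  have adj: "hor E x y \<longleftrightarrow> {(x, y), (x + 1, y)} \<in> E" "dia E x y \<longleftrightarrow> {(x, y), (x + 1, y + 1)} \<in> E"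
    "ver E x y \<longleftrightarrow> {(x, y), (x, y + 1)} \<in> E" "anti E (x - 1) y \<longleftrightarrow> {(x, y), (x - 1, y + 1)} \<in> E"
    "hor E (x - 1) y \<longleftrightarrow> {(x, y), (x - 1, y)} \<in> E" "dia E (x - 1) (y - 1) \<longleftrightarrow> {(x, y), (x - 1, y - 1)} \<in> E"
    "ver E x (y - 1) \<longleftrightarrow> {(x, y), (x, y - 1)} \<in> E" "anti E x (y - 1) \<longleftrightarrow> {(x, y), (x + 1, y - 1)} \<in> E"
    by (simp_all add: hor_def dia_def ver_def anti_def adj_def insert_commute)
  have four: False if "{(x, y), p} \<in> E" "{(x, y), q} \<in> E" "{(x, y), r} \<in> E" "{(x, y), s} \<in> E" "distinct [p, q, r, s]" for p q r s
    using degree_le_3[OF E that(5,1-4)] .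
  show ?thesis
    unfolding at_most_3_def adj
    by (intro conjI notI; elim conjE disjE; (rule four, assumption, assumption, assumption, assumption, (simp; fail)))
qed

lemma diagonals_disjoint:
  assumes E: "local_spanner E"
  shows "\<not> (dia E x y \<and> anti E x y)"
proof
  assume "dia E x y \<and> anti E x y"
  then have e: "{(x, y), (x + 1, y + 1)} \<in> E" "{(x + 1, y), (x, y + 1)} \<in> E"
    by (simp_all add: dia_def anti_def adj_def)
  have "(x + 1 / 2, y + 1 / 2) \<in> closed_segment (pt (x, y)) (pt (x + 1, y + 1))"
    "(x + 1 / 2, y + 1 / 2) \<in> closed_segment (pt (x + 1, y)) (pt (x, y + 1))"
    by (rule in_segment_pt[of "1 / 2"]; simp add: field_simps)+
  from no_crossing[OF E e _ this] show False
    by (auto simp: doubleton_eq_iff)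
qed

lemma horizontal_pair:
  assumes E: "local_spanner E"
  shows "hor E x y \<or> ver E x y \<and> anti E x y \<or> dia E x y \<and> ver E (x + 1) y
    \<or> ver E x (y - 1) \<and> dia E x (y - 1) \<or> anti E x (y - 1) \<and> ver E (x + 1) (y - 1)"
  using unit_pair[OF E, of 1 0 0 1 x y]
  by (auto simp: signed_perm_def hor_def ver_def dia_def anti_def adj_def insert_commute)

lemma vertical_pair:
  assumes E: "local_spanner E"
  shows "ver E x y \<or> hor E x y \<and> anti E x y \<or> dia E x y \<and> hor E x (y + 1)
    \<or> hor E (x - 1) y \<and> dia E (x - 1) y \<or> anti E (x - 1) y \<and> hor E (x - 1) (y + 1)"
  using unit_pair[OF E, of 0 1 1 0 x y]
  by (auto simp: signed_perm_def hor_def ver_def dia_def anti_def adj_def insert_commute)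

subsection \<open>Knight moves\<close>

text \<open>The longer paths from \<open>(-1, 0)\<close> to \<open>(1, 1)\<close> that the conditions on unit pairs, degrees and crossings
  do not exclude. A prime stands for the half-turn about the midpoint of the two end points.\<close>

abbreviation "alpha \<equiv> [(-1, 0), (-1, 1), (-1, 2), (0, 2), (1, 2), (1, 1)] :: vertex list"
abbreviation "alpha' \<equiv> [(1, 1), (1, 0), (1, -1), (0, -1), (-1, -1), (-1, 0)] :: vertex list"
abbreviation "beta \<equiv> [(-1, 0), (0, -1), (1, 0), (2, 1), (1, 1)] :: vertex list"
abbreviation "beta' \<equiv> [(1, 1), (0, 2), (-1, 1), (-2, 0), (-1, 0)] :: vertex list"
abbreviation "gamma \<equiv> [(-1, 0), (0, -1), (1, 0), (2, 0), (1, 1)] :: vertex list"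
abbreviation "gamma' \<equiv> [(1, 1), (0, 2), (-1, 1), (-2, 1), (-1, 0)] :: vertex list"

text \<open>In the following proofs the listed instances form an unsatisfiable core, found with a SAT solver,
  of the local conditions in a window around the pair.\<close>

lemma route_5_0:
  assumes E: "local_spanner E" and c: "route 5 E 0 [] (-1) 0 1 1"
  shows "short E (-1) 0 1 1 \<or> (\<exists>ps \<in> {alpha, alpha'}. successively (adj E) ps)"
proof (rule ccontr)
  assume n: "\<not> ?thesis"
  \<comment> \<open>With these rules, routes between numerals and the local conditions become
    propositional formulas whose atoms are single edges.\<close>
  note [simp] = short_def eval_nat_numeral adj_cases frame_def signed_perm_def
  note D = vertex_degree[OF E] and X = diagonals_disjoint[OF E]
    and Uh = horizontal_pair[OF E] and Uv = vertical_pair[OF E]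
  note U =
    Uh[of "-1" 0] Uh[of "-1" 1] Uh[of 0 0] Uh[of 0 1] Uv[of "-1" 0] Uv[of 1 0]
  show False
    using n[simplified] c[simplified] U[unfolded at_most_3_def, simplified]
    by (smt (verit))
qed

text \<open>Degree and crossing conditions join the unit pairs here and cut the routes with one unit
  and three diagonal edges down to two shapes and their half-turns.\<close>

lemma route_4_3:
  assumes E: "local_spanner E" and c: "route 4 E 3 [] (-1) 0 1 1"
  shows "short E (-1) 0 1 1 \<or> (\<exists>ps \<in> {beta, beta', gamma, gamma'}. successively (adj E) ps)"
proof (rule ccontr)
  assume n: "\<not> ?thesis"
  note [simp] = short_def eval_nat_numeral adj_cases frame_def signed_perm_def
  note D = vertex_degree[OF E] and X = diagonals_disjoint[OF E]
    and Uh = horizontal_pair[OF E] and Uv = vertical_pair[OF E]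
  note U =
    D[of "-2" 1] D[of "-1" 1] D[of "-1" 2] D[of 0 "-1"] D[of 0 1] D[of 0 2] D[of 1 "-1"] D[of 2 0]
    X[of "-1" "-1"] X[of "-1" 1] X[of 0 "-1"] X[of 0 1] X[of 1 "-1"] X[of 1 0] Uh[of "-2" 1]
    Uh[of "-2" 2] Uh[of "-1" 0] Uh[of "-1" 1] Uh[of "-1" 2] Uh[of 0 0] Uh[of 0 1] Uv[of "-1" 0]
    Uv[of "-1" 1] Uv[of 0 "-2"] Uv[of 0 "-1"] Uv[of 0 0] Uv[of 0 1] Uv[of 0 2] Uv[of 1 "-1"]
    Uv[of 1 0] Uv[of 2 "-1"]
  show False
    using n[simplified] c[simplified] U[unfolded at_most_3_def, simplified]
    by (smt (verit))
qed

section \<open>Elimination of the detours\<close>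

lemma short_or_detour:
  assumes E: "local_spanner E"
  shows "short E (-1) 0 1 1 \<or> (\<exists>ps \<in> {alpha, alpha', beta, beta', gamma, gamma'}. successively (adj E) ps)"
  using knight_cases[OF E] route_5_0[OF E] route_4_3[OF E] unfolding bex_simps by blast

text \<open>The same alternative for every placement of a knight's move. It turns nearby knight's
  moves into further constraints on the edges around a detour.\<close>

lemma short_or_detour_frame:
  assumes E: "local_spanner E" and sp: "signed_perm a b c d"
  shows "short E (s - a) (t - c) (s + a + b) (t + c + d) \<or>
    (\<exists>ps \<in> {alpha, alpha', beta, beta', gamma, gamma'}. successively (adj E) (map (frame a b c d s t) ps))"
  by (rule disj_forward[OF short_or_detour[OF local_spanner_pull[OF E sp], unfolded successively_adj_pull]
        short_pull[OF E sp]])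

lemma beta_short:
  assumes E: "local_spanner E" and c: "successively (adj E) beta"
  shows "short E (-1) 0 1 1"
proof (rule ccontr)
  assume n: "\<not> ?thesis"
  note [simp] = short_def eval_nat_numeral adj_cases frame_def signed_perm_def
  note D = vertex_degree[OF E] and X = diagonals_disjoint[OF E]
    and Uh = horizontal_pair[OF E] and Uv = vertical_pair[OF E] and K = short_or_detour_frame[OF E]
  note U =
    D[of "-2" 0] D[of "-2" 1] D[of "-1" "-1"] D[of "-1" 0] D[of "-1" 1] D[of 0 "-1"] D[of 1 0]
    X[of "-1" "-1"] X[of 0 "-1"] Uh[of "-3" 1] Uh[of "-2" 0] Uh[of 0 0] Uh[of 0 1] Uv[of "-1" 1]
    Uv[of 0 "-2"] Uv[of 1 "-1"]
  \<comment> \<open>The three knight's moves used join \<open>(-2, -1)\<close> and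
    \<open>(-1, -2)\<close> to \<open>(0, 0)\<close>, and \<open>(-1, -1)\<close> to
    \<open>(0, 1)\<close>; \<open>gamma_short\<close> uses the same ones.\<close>
  note K' =
    K[of 1 0 0 1 "-1" "-1"] K[of 0 1 1 0 "-1" "-1"] K[of 0 1 1 0 "-1" 0]
  show False
    using n[simplified] c[simplified] U[unfolded at_most_3_def, simplified] K'[simplified]
    by (smt (verit))
qed

lemma gamma_short:
  assumes E: "local_spanner E" and c: "successively (adj E) gamma"
  shows "short E (-1) 0 1 1"
proof (rule ccontr)
  assume n: "\<not> ?thesis"
  note [simp] = short_def eval_nat_numeral adj_cases frame_def signed_perm_def
  note D = vertex_degree[OF E] and X = diagonals_disjoint[OF E]
    and Uh = horizontal_pair[OF E] and Uv = vertical_pair[OF E] and K = short_or_detour_frame[OF E]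
  note U =
    D[of "-2" 0] D[of "-2" 1] D[of "-1" "-1"] D[of "-1" 0] D[of "-1" 1] D[of 0 "-2"] D[of 0 "-1"]
    D[of 1 "-1"] D[of 1 0] D[of 2 0] X[of "-1" "-1"] X[of 0 "-1"] Uh[of "-3" 1] Uh[of "-2" 0]
    Uh[of 0 "-2"] Uh[of 0 "-1"] Uh[of 0 0] Uh[of 0 1] Uv[of "-1" 1] Uv[of 0 "-2"] Uv[of 1 "-1"]
    Uv[of 2 "-1"]
  note K' =
    K[of 1 0 0 1 "-1" "-1"] K[of 0 1 1 0 "-1" "-1"] K[of 0 1 1 0 "-1" 0]
  show False
    using n[simplified] c[simplified] U[unfolded at_most_3_def, simplified] K'[simplified]
    by (smt (verit))
qed

text \<open>This half-turn about \<open>(0, 1/2)\<close> exchanges \<open>(-1, 0)\<close> and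
  \<open>(1, 1)\<close>, so the transported short connection runs backwards and has to be
  reversed.\<close>

lemma short_rotate:
  assumes E: "local_spanner E" and s: "short (pull (frame (-1) 0 0 (-1) 0 1) E) (-1) 0 1 1"
  shows "short E (-1) 0 1 1"
proof (rule reaches_imp_short[OF E])
  have "short E 1 1 (-1) 0"
    using short_pull[OF E _ s] by (simp add: signed_perm_def)
  then show "reaches E (-1, 0) (1, 1) (3 + sqrt 2)"
    by (intro reaches_sym[OF short_imp_reaches])
qed auto

lemma rotate_short:
  assumes E: "local_spanner E" and c: "successively (adj E) (map (frame (-1) 0 0 (-1) 0 1) ps)"
    and "\<And>E. local_spanner E \<Longrightarrow> successively (adj E) ps \<Longrightarrow> short E (-1) 0 1 1"
  shows "short E (-1) 0 1 1"
proof -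
  have "local_spanner (pull (frame (-1) 0 0 (-1) 0 1) E)"
    by (rule local_spanner_pull[OF E]) (simp add: signed_perm_def)
  with assms(2,3) show ?thesis
    by (intro short_rotate[OF E]) (simp add: successively_adj_pull)
qed

text \<open>With \<open>beta\<close>, \<open>gamma\<close> and their half-turns eliminated, only
  detours of five unit edges remain. The sharper alternative is what \<open>alpha_short\<close>
  applies to surrounding knight's moves.\<close>

lemma short_or_alpha:
  assumes E: "local_spanner E"
  shows "short E (-1) 0 1 1 \<or> (\<exists>ps \<in> {alpha, alpha'}. successively (adj E) ps)"
proof -
  have "successively (adj E) beta' \<Longrightarrow> short E (-1) 0 1 1" "successively (adj E) gamma' \<Longrightarrow> short E (-1) 0 1 1"
    using rotate_short[OF E, of beta] rotate_short[OF E, of gamma] beta_short gamma_short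
    by (simp_all add: frame_def)
  then show ?thesis
    using short_or_detour[OF E] beta_short[OF E] gamma_short[OF E] unfolding bex_simps by blast
qed

lemma short_or_alpha_frame:
  assumes E: "local_spanner E" and sp: "signed_perm a b c d"
  shows "short E (s - a) (t - c) (s + a + b) (t + c + d) \<or>
    (\<exists>ps \<in> {alpha, alpha'}. successively (adj E) (map (frame a b c d s t) ps))"
  by (rule disj_forward[OF short_or_alpha[OF local_spanner_pull[OF E sp], unfolded successively_adj_pull]
        short_pull[OF E sp]])

text \<open>The contradiction needs a larger window than before: degree conditions reach out to
  coordinates of absolute value 3, and nineteen other knight's moves enter, each of them short or
  with an \<open>alpha\<close> detour of its own.\<close>

lemma alpha_short:
  assumes E: "local_spanner E" and c: "successively (adj E) alpha"
  shows "short E (-1) 0 1 1"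
proof (rule ccontr)
  assume n: "\<not> ?thesis"
  note [simp] = short_def eval_nat_numeral adj_cases frame_def signed_perm_def
  note D = vertex_degree[OF E] and X = diagonals_disjoint[OF E]
    and Uh = horizontal_pair[OF E] and Uv = vertical_pair[OF E] and K = short_or_alpha_frame[OF E]
  note U =
    D[of "-3" 0] D[of "-3" 2] D[of "-3" 3] D[of "-2" "-2"] D[of "-2" "-1"] D[of "-2" 0]
    D[of "-2" 1] D[of "-2" 2] D[of "-2" 3] D[of "-1" "-3"] D[of "-1" "-2"] D[of "-1" "-1"]
    D[of "-1" 0] D[of "-1" 1] D[of "-1" 2] D[of "-1" 3] D[of 0 "-3"] D[of 0 "-2"] D[of 0 "-1"]
    D[of 0 0] D[of 0 2] D[of 1 "-2"] D[of 1 "-1"] D[of 1 0] D[of 1 1] D[of 1 2] D[of 2 "-1"]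
    D[of 2 0] D[of 2 1] D[of 3 0] Uh[of "-3" "-2"] Uh[of "-3" 2] Uh[of "-2" "-1"] Uh[of "-2" 1]
    Uh[of "-2" 2] Uh[of "-1" "-3"] Uh[of "-1" "-2"] Uh[of "-1" 1] Uh[of 0 "-1"] Uh[of 0 1]
    Uh[of 1 "-2"] Uh[of 1 0] Uh[of 1 2] Uv[of "-3" "-1"] Uv[of "-3" 1] Uv[of "-3" 3]
    Uv[of "-2" "-1"] Uv[of "-2" 1] Uv[of "-2" 2] Uv[of "-1" "-2"] Uv[of "-1" "-1"] Uv[of "-1" 2]
    Uv[of 0 0] Uv[of 0 2] Uv[of 1 "-2"] Uv[of 1 "-1"] Uv[of 1 2] Uv[of 2 "-2"] Uv[of 2 "-1"]
    Uv[of 2 0] Uv[of 3 0]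
  note K' =
    K[of 1 0 0 1 "-2" 1] K[of 1 0 0 "-1" "-2" 3] K[of 0 1 1 0 "-2" "-1"] K[of 1 0 0 1 "-1" "-2"]
    K[of 0 1 1 0 "-2" 1] K[of 1 0 0 1 "-1" 0] K[of 0 1 1 0 "-2" 2] K[of 1 0 0 "-1" "-1" 1]
    K[of 1 0 0 "-1" "-1" 2] K[of 0 1 "-1" 0 "-2" 3] K[of 0 1 1 0 "-1" "-1"] K[of 1 0 0 "-1" 0 "-1"]
    K[of 1 0 0 1 0 "-1"] K[of 1 0 0 "-1" 0 0] K[of 0 1 "-1" 0 "-1" 2] K[of 0 1 1 0 0 "-1"]
    K[of 1 0 0 1 1 0] K[of 0 1 1 0 0 2] K[of 1 0 0 1 1 1]
  show False
    using n[simplified] c[simplified] U[unfolded at_most_3_def, simplified] K'[simplified]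
    by (smt (verit))
qed

lemma knight_is_short:
  assumes E: "local_spanner E"
  shows "short E (-1) 0 1 1"
proof -
  have "successively (adj E) alpha' \<Longrightarrow> short E (-1) 0 1 1"
    using rotate_short[OF E, of alpha] alpha_short by (simp add: frame_def)
  then show ?thesis
    using short_or_alpha[OF E] alpha_short[OF E] unfolding bex_simps by blast
qed

subsection \<open>The dilation\<close>

lemma walk_pull:
  assumes "walk (pull (frame a b c d s t) E) p q L" and sp: "signed_perm a b c d"
  shows "walk E (frame a b c d s t p) (frame a b c d s t q) L"
  using reaches_imp_walk[OF reaches_pull[OF walk_imp_reaches[OF assms(1)] sp]] .

text \<open>The premise ranges over all local spanners, so the step from the origin is available at
  every translate; \<open>n\<close> consecutive copies are concatenated.\<close>

lemma walk_multiple: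
  assumes "\<And>E. local_spanner E \<Longrightarrow> walk E (0, 0) (u, v) L" and "local_spanner E"
  shows "walk E (x, y) (x + int n * u, y + int n * v) (real n * L)"
proof (induction n)
  case 0
  then show ?case by (simp add: walk_refl)
next
  case (Suc n)
  have sp: "signed_perm 1 0 0 1"
    by (simp add: signed_perm_def)
  let ?T = "frame 1 0 0 1 (x + int n * u) (y + int n * v)"
  have "walk E (?T (0, 0)) (?T (u, v)) L"
    by (rule walk_pull[OF assms(1)[OF local_spanner_pull[OF assms(2) sp]] sp])
  then have "walk E (x + int n * u, y + int n * v) (x + int (Suc n) * u, y + int (Suc n) * v) L"
    by (simp add: frame_def algebra_simps)
  from walk_trans[OF Suc.IH this] show ?case
    by (simp add: algebra_simps)
qed

lemma unit_walk:
  assumes "local_spanner E"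
  shows "walk E (0, 0) (1, 0) (1 + sqrt 2)"
  using local_spannerD(5)[OF assms, of "(0, 0)" "(1, 0)"] by (simp add: dist_pt reaches_imp_walk)

lemma diagonal_walk:
  assumes "local_spanner E"
  shows "walk E (0, 0) (1, 1) (2 + sqrt 2)"
proof -
  have "reaches E (0, 0) (1, 1) ((1 + sqrt 2) * sqrt 2)"
    using local_spannerD(5)[OF assms, of "(0, 0)" "(1, 1)"] by (simp add: dist_pt)
  then show ?thesis
    by (simp add: distrib_right reaches_imp_walk add.commute)
qed

lemma knight_walk:
  assumes E: "local_spanner E"
  shows "walk E (0, 0) (2, 1) (3 + sqrt 2)"
proof -
  have sp: "signed_perm 1 0 0 1"
    by (simp add: signed_perm_def)
  have "short E 0 0 2 1"
    using short_pull[OF E sp knight_is_short[OF local_spanner_pull[OF E sp]], of 1 0] by simp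
  then show ?thesis
    by (intro reaches_imp_walk short_imp_reaches)
qed

lemma octant_walk:
  assumes E: "local_spanner E" and xy: "0 \<le> y" "y \<le> x"
  shows "walk E (0, 0) (x, y) ((1 + sqrt 2) * sqrt ((real_of_int x)\<^sup>2 + (real_of_int y)\<^sup>2))"
proof (cases "2 * y \<le> x")
  case True
  \<comment> \<open>Slope at most 1/2: \<open>(x, y)\<close> is \<open>y\<close> knight vectors plus
    \<open>x - 2 * y\<close> horizontal units. The total
    \<open>(1 + sqrt 2) * x + (1 - sqrt 2) * y\<close> is at most
    \<open>(1 + sqrt 2) * x\<close>.\<close>
  define n where "n = nat (x - 2 * y)"
  have "walk E (0, 0) (2 * y, y) (real (nat y) * (3 + sqrt 2))"
    using walk_multiple[OF knight_walk E, of 0 0 "nat y"] xy by (simp add: mult.commute)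
  moreover have "walk E (2 * y, y) (2 * y + int n * 1, y + int n * 0) (real n * (1 + sqrt 2))"
    by (rule walk_multiple[OF unit_walk E])
  ultimately have "walk E (0, 0) (x, y) (real (nat y) * (3 + sqrt 2) + real n * (1 + sqrt 2))"
    using True xy by (intro walk_trans[of E _ "(2 * y, y)"]) (simp_all add: n_def mult.commute)
  moreover have "real (nat y) * (3 + sqrt 2) + real n * (1 + sqrt 2) \<le> (1 + sqrt 2) * real_of_int x"
  proof -
    have "real_of_int y * 1 \<le> real_of_int y * sqrt 2"
      using xy by (intro mult_left_mono) auto
    then show ?thesis
      using True xy by (simp add: n_def algebra_simps)
  qed
  moreover have "(1 + sqrt 2) * real_of_int x \<le> (1 + sqrt 2) * sqrt ((real_of_int x)\<^sup>2 + (real_of_int y)\<^sup>2)"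
    by (intro mult_left_mono real_le_rsqrt) simp_all
  ultimately show ?thesis
    by (meson walk_mono order_trans)
next
  case False
  \<comment> \<open>Slope above 1/2: the solution of \<open>2 * n + m = x\<close> and
    \<open>n + m = y\<close>, with \<open>n\<close> knight vectors and \<open>m\<close> diagonals.
    The total is \<open>x + (1 + sqrt 2) * y\<close>.\<close>
  define m n where "m = nat (2 * y - x)" and "n = nat (x - y)"
  have "walk E (0, 0) (int n * 2, int n) (real n * (3 + sqrt 2))"
    using walk_multiple[OF knight_walk E, of 0 0 n] by simp
  moreover have "walk E (int n * 2, int n) (int n * 2 + int m * 1, int n + int m * 1) (real m * (2 + sqrt 2))"
    by (rule walk_multiple[OF diagonal_walk E])
  ultimately have "walk E (0, 0) (x, y) (real n * (3 + sqrt 2) + real m * (2 + sqrt 2))"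
    using False xy by (intro walk_trans[of E _ "(int n * 2, int n)"]) (simp_all add: n_def m_def)
  moreover have "real n * (3 + sqrt 2) + real m * (2 + sqrt 2) \<le> (1 + sqrt 2) * sqrt ((real_of_int x)\<^sup>2 + (real_of_int y)\<^sup>2)"
  proof -
    have le: "real_of_int y \<le> real_of_int x" "0 \<le> real_of_int y"
      using xy by auto
    have "real n * (3 + sqrt 2) + real m * (2 + sqrt 2) = real_of_int x + (1 + sqrt 2) * real_of_int y"
      using False xy by (simp add: n_def m_def algebra_simps)
    moreover have "(real_of_int x + (1 + sqrt 2) * real_of_int y)\<^sup>2
        \<le> ((1 + sqrt 2) * sqrt ((real_of_int x)\<^sup>2 + (real_of_int y)\<^sup>2))\<^sup>2"
    proof -
      \<comment> \<open>The gap between the squares factors explicitly, and its sign is that of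
        \<open>x * (x - y)\<close>, nonnegative in the octant.\<close>
      have "(1 + sqrt 2)\<^sup>2 * ((real_of_int x)\<^sup>2 + (real_of_int y)\<^sup>2) - (real_of_int x + (1 + sqrt 2) * real_of_int y)\<^sup>2
          = 2 * (1 + sqrt 2) * real_of_int x * (real_of_int x - real_of_int y)"
        by (simp add: power2_eq_square algebra_simps)
      moreover have "0 \<le> 2 * (1 + sqrt 2) * real_of_int x * (real_of_int x - real_of_int y)"
        using le by (intro mult_nonneg_nonneg) auto
      ultimately show ?thesis
        by (simp add: power_mult_distrib)
    qed
    ultimately show ?thesis
      by (simp only: power2_le_imp_le mult_nonneg_nonneg real_sqrt_ge_zero add_nonneg_nonneg
          zero_le_power2 zero_le_one real_sqrt_ge_zero zero_le_numeral)
  qed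
  ultimately show ?thesis
    by (rule walk_mono)
qed

lemma local_spanner_reaches:
  assumes E: "local_spanner E"
  shows "reaches E p q ((1 + sqrt 2) * dist (pt p) (pt q))"
proof -
  obtain a b c d x y where xy: "0 \<le> y" "y \<le> x" and sp: "signed_perm a b c d"
    and pq: "fst q - fst p = a * x + b * y" "snd q - snd p = c * x + d * y"
    by (rule lattice_orientation)
  let ?T = "frame a b c d (fst p) (snd p)"
  have T: "?T (0, 0) = p" "?T (x, y) = q"
    using pq by (auto simp: frame_def prod_eq_iff)
  have "dist (pt p) (pt q) = sqrt ((real_of_int x)\<^sup>2 + (real_of_int y)\<^sup>2)"
    using dist_frame[OF sp, of "fst p" "snd p" "(0, 0)" "(x, y)"] unfolding T by (simp add: dist_pt)
  then show ?thesis
    using walk_imp_reaches[OF walk_pull[OF octant_walk[OF local_spanner_pull[OF E sp] xy] sp], of "fst p" "snd p"]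
    unfolding T by simp
qed

section \<open>Lower bound on the dilation\<close>

lemma unit_pair_missing:
  assumes E: "max_degree_le 3 E"
  shows "\<exists>p q. dist (pt p) (pt q) = 1 \<and> {p, q} \<notin> E"
proof (rule ccontr)
  assume n: "\<not> ?thesis"
  let ?S = "{{(0, 0), (1, 0)}, {(0, 0), (0, 1)}, {(0, 0), (-1, 0)}, {(0, 0), (0, -1)}} :: edges"
  have "?S \<subseteq> {e \<in> E. (0, 0) \<in> e}"
    using n by (auto simp: dist_pt)
  moreover have "finite {e \<in> E. (0, 0) \<in> e}" and le: "card {e \<in> E. (0, 0) \<in> e} \<le> 3"
    using E unfolding max_degree_le_def by blast+
  ultimately have "card ?S \<le> card {e \<in> E. (0, 0) \<in> e}"
    by (intro card_mono)
  moreover have "card ?S = 4"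
    by (simp add: doubleton_eq_iff card_insert_if)
  ultimately show False
    using le by linarith
qed

text \<open>Let \<open>r\<close> be the second vertex of the path. The ends have opposite colours in
  the checkerboard colouring, so the squared distances from \<open>r\<close> to them have odd sum;
  both are positive, so one is at least 1 and the other at least 2. The triangle inequality covers
  the rest of the path.\<close>

lemma detour_ge:
  assumes d: "dist (pt p) (pt q) = 1" and e: "{p, q} \<notin> E" and r: "reaches E p q L"
  shows "1 + sqrt 2 \<le> L"
proof -
  have sq: "(fst p - fst q)\<^sup>2 + (snd p - snd q)\<^sup>2 = 1"
    using d unfolding dist_pt by (simp flip: of_int_diff of_int_power of_int_add)
  obtain xs where xs: "graph_path E p q xs" "path_len xs \<le> L"
    using r by (auto simp: reaches_def)
  have "p \<noteq> q"
    using d by auto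
  with xs(1) obtain r ys where ys: "xs = p # r # ys"
    unfolding graph_path_def by (metis last_ConsL list.collapse)
  with xs(1) have "{p, r} \<in> E" "r \<noteq> p"
    by (auto simp: graph_path_def)
  with e have r: "r \<noteq> p" "r \<noteq> q"
    by auto
  have q: "q \<in> set (r # ys)"
    using xs(1) ys unfolding graph_path_def by (metis last_ConsR last_in_set list.distinct(1))
  define m n where "m = (fst p - fst r)\<^sup>2 + (snd p - snd r)\<^sup>2" and "n = (fst r - fst q)\<^sup>2 + (snd r - snd q)\<^sup>2"
  \<comment> \<open>A squared lattice distance has the parity of the difference of the coordinate
    sums.\<close>
  have "even m \<longleftrightarrow> even (fst p + fst r + snd p + snd r)" "even n \<longleftrightarrow> even (fst r + fst q + snd r + snd q)"
    unfolding m_def n_def by simp_all presburger+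
  moreover have "odd ((fst p - fst q)\<^sup>2 + (snd p - snd q)\<^sup>2)"
    unfolding sq by simp
  then have "odd (fst p + fst q + snd p + snd q)"
    by simp presburger
  ultimately have "odd (m + n)"
    by presburger
  moreover have "0 < m" "0 < n"
    using r unfolding m_def n_def by (auto simp: sum_power2_gt_zero_iff prod_eq_iff)
  ultimately have "1 \<le> m \<and> 2 \<le> n \<or> 2 \<le> m \<and> 1 \<le> n"
    by presburger
  moreover have "1 \<le> j \<Longrightarrow> 1 \<le> sqrt (real_of_int j)" "2 \<le> j \<Longrightarrow> sqrt 2 \<le> sqrt (real_of_int j)" for j
    by simp_all
  ultimately have "1 + sqrt 2 \<le> sqrt (real_of_int m) + sqrt (real_of_int n)"
    by (metis add.commute add_mono)
  also have "\<dots> = dist (pt p) (pt r) + dist (pt r) (pt q)"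
    by (simp add: dist_pt m_def n_def)
  also have "\<dots> \<le> path_len xs"
    using dist_le_path_len[OF q] unfolding ys by simp
  finally show ?thesis
    using xs(2) by simp
qed

theorem theorem1p3:
  shows "\<M>\<^sub>l\<^sub>o\<^sub>c = \<M>"
proof (intro set_eqI iffI)
  fix E assume "E \<in> \<M>"
  then have E: "geometric_graph E" "plane_graph E" "max_degree_le 3 E" "dil E = ereal (1 + sqrt 2)"
    by (simp_all add: optimal_graphs_def)
  have "dil_pair E p q \<le> dil E" if "p \<noteq> q" for p q
    unfolding dil_def using that by (intro SUP_upper2[of "(p, q)"]) auto
  then show "E \<in> \<M>\<^sub>l\<^sub>o\<^sub>c"
    using E unfolding locally_optimal_graphs_def by simp
next
  fix E assume "E \<in> \<M>\<^sub>l\<^sub>o\<^sub>c"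
  then have E: "local_spanner E"
    by (simp add: locally_optimal_iff)
  have "dil E \<le> ereal (1 + sqrt 2)"
    unfolding dil_def
  proof (rule SUP_least)
    fix pq :: "vertex \<times> vertex"
    assume "pq \<in> {(p, q). p \<noteq> q}"
    then show "(case pq of (p, q) \<Rightarrow> dil_pair E p q) \<le> ereal (1 + sqrt 2)"
      by (cases pq) (simp add: dil_pair_le_iff local_spanner_reaches[OF E])
  qed
  \<comment> \<open>Equality needs a pair of large dilation: a missing unit edge works, since at
    distance 1 the dilation is the graph distance, and this is at least \<open>1 + sqrt 2\<close>
    even if no path exists.\<close>
  moreover have "ereal (1 + sqrt 2) \<le> dil E"
  proof -
    have "max_degree_le 3 E"
      using E unfolding local_spanner_def by (elim conjE)
    from unit_pair_missing[OF this] obtain p q where pq: "dist (pt p) (pt q) = 1" "{p, q} \<notin> E"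
      by (elim exE conjE)
    have "ereal (1 + sqrt 2) \<le> graph_dist E p q"
      unfolding graph_dist_def
    proof (rule INF_greatest)
      fix xs assume "xs \<in> {xs. graph_path E p q xs}"
      then have "reaches E p q (path_len xs)"
        by (auto simp: reaches_def)
      then show "ereal (1 + sqrt 2) \<le> ereal (path_len xs)"
        using detour_ge[OF pq] by simp
    qed
    also have "\<dots> = dil_pair E p q"
      by (simp add: dil_pair_def pq(1) flip: one_ereal_def)
    also have "\<dots> \<le> dil E"
      unfolding dil_def using pq(1) by (intro SUP_upper2[of "(p, q)"]) auto
    finally show ?thesis .
  qed
  ultimately show "E \<in> \<M>"
    using E by (simp add: optimal_graphs_def local_spanner_def)
qed

end
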